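(* Let $\{\lambda_n\}_{n=1}^\infty$ be an admissible scale. Let $r,s$ be nonnegative integers, let $\ell>0$, let $\alpha_1,\dots,\alpha_r>0$ and $\beta_1,\dots,\beta_s>0$ be fixed, and for $v\in\mathbb{R}$ and $n\ge 1$ put $$z=e^{2\pi v},\qquad q=e^{-\pi\lambda_n^{-1}},\qquad a_j=q^{\alpha_j}\ (1\le j\le r),\qquad b_k=q^{\beta_k}\ (1\le k\le s).$$ Write $g(w;q):=g(a_1,\dots,a_r;b_1,\dots,b_s;q;\ell;w)$. Then, as $n\to\infty$, $$g(-q^{-4n\ell}z;q)=\exp\left\{\frac{\pi\lambda_n}{\ell}\left(v+\frac{2n\ell}{\lambda_n}\right)^2\right\}\sqrt{\frac{\lambda_n}{\ell}}\left\{1+\mathcal{O}\left(e^{-\ell^{-1}\pi\lambda_n}\right)\right\}$$ and $$g(q^{-4n\ell}z;q)=\exp\left\{\frac{\pi\lambda_n}{\ell}\left(v+\frac{2n\ell}{\lambda_n}\right)^2-\frac{\pi\lambda_n}{4\ell}\right\}\,2\sqrt{\frac{\lambda_n}{\ell}}\left\{\cos\frac{\pi\lambda_n v}{\ell}+\mathcal{O}\left(e^{-2\ell^{-1}\pi\lambda_n}\right)\right\},$$ where the $\mathcal{O}$-terms are uniform for $v$ in any compact subset of $\mathbb{R}$.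
   Context: An admissible scale is a sequence $\{\lambda_n\}_{n=1}^\infty$ of positive numbers such that $\lim_{n\to\infty}\lambda_n/\log n=\infty$ and $\lim_{n\to\infty} n/\lambda_n^2=\infty$. For $0<q<1$ and $a\in\mathbb{C}$, $(a;q)_\infty:=\prod_{k=0}^\infty(1-aq^k)$, and $(a_1,\dots,a_m;q)_\infty:=\prod_{j=1}^m(a_j;q)_\infty$ (empty products equal $1$). For nonnegative integers $r,s$, a positive number $\ell$, and $0\le a_1,\dots,a_r,b_1,\dots,b_s<1$, define $$g(a_1,\dots,a_r;b_1,\dots,b_s;q;\ell;w):=\sum_{k=0}^\infty\frac{(q^{k+1},b_1q^k,\dots,b_sq^k;q)_\infty\,q^{\ell k^2}(-w)^k}{(a_1q^k,\dots,a_rq^k;q)_\infty}.$$ Note that $q$ (and hence $a_j,b_k$) depends on $n$. *)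

theory Defs
  imports "HOL-Analysis.Analysis" "HOL-Library.Landau_Symbols"
begin

(* Sequences are indexed from 1; the value at index 0 is irrelevant. *)
definition admissible_scale :: "(nat \<Rightarrow> real) \<Rightarrow> bool" where
  "admissible_scale lam \<longleftrightarrow>
     (\<forall>n\<ge>1. lam n > 0) \<and>
     filterlim (\<lambda>n. lam n / ln (real n)) at_top sequentially \<and>
     filterlim (\<lambda>n. real n / (lam n)\<^sup>2) at_top sequentially"

definition qpoch_inf :: "complex \<Rightarrow> real \<Rightarrow> complex" where
  "qpoch_inf a q = (\<Prod>k. 1 - a * of_real q ^ k)"

definition qpochs_inf :: "complex list \<Rightarrow> real \<Rightarrow> complex" where
  "qpochs_inf as q = (\<Prod>a\<leftarrow>as. qpoch_inf a q)"

(* The parameter lists are a_1,...,a_r and b_1,...,b_s; the intended domain is 0 < q < 1,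
   l > 0 and all parameters in [0,1). *)
definition qseries_g ::
    "real list \<Rightarrow> real list \<Rightarrow> real \<Rightarrow> real \<Rightarrow> complex \<Rightarrow> complex" where
  "qseries_g as bs q l w =
     (\<Sum>k. qpochs_inf (of_real (q ^ (k + 1)) # map (\<lambda>b. of_real (b * q ^ k)) bs) q
           * of_real (q powr (l * (real k)\<^sup>2)) * (- w) ^ k
           / qpochs_inf (map (\<lambda>a. of_real (a * q ^ k)) as) q)"

(* f(n,v) = O(h(n,v)) as n tends to infinity, uniformly for v in any compact set:
   for each compact K there are C and N with |f n v| <= C |h n v| for all n >= N, v in K. *)
definition bigo_loc_unif :: "(nat \<Rightarrow> real \<Rightarrow> real) \<Rightarrow> (nat \<Rightarrow> real \<Rightarrow> real) \<Rightarrow> bool" where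
  "bigo_loc_unif f h \<longleftrightarrow>
     (\<forall>K. compact K \<longrightarrow>
        (\<lambda>(n, v). f n v) \<in> O[sequentially \<times>\<^sub>F principal K](\<lambda>(n, v). h n v))"

end

theory Submission
  imports Defs "HOL-Probability.Characteristic_Functions"
begin

text \<open>Put \<open>t = l / lam n\<close> and \<open>X = 2 n + v / t\<close>.  Completing the square in
\<open>q powr (l k\<^sup>2) * (q powr (- 4 n l) * z) ^ k\<close> pulls out exactly the exponential prefactor of the
claim and turns the series at \<open>- s q powr (- 4 n l) z\<close>, with \<open>s = 1\<close> or \<open>s = -1\<close>, into the sum over
\<open>k \<ge> 0\<close> of \<open>s ^ k c\<^sub>k exp (- \<pi> t (k - X)\<^sup>2)\<close>, where \<open>c\<^sub>k\<close> is the quotient of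
q-shifted factorials (\<open>qseries_g_gauss\<close>).  All these weights are real.

The mass of this sum sits near \<open>k = X\<close>, that is near \<open>2 n\<close>, and there
\<open>c\<^sub>k\<close> is extremely close to 1: \<open>\<bar>c\<^sub>k - 1\<bar> \<le> exp (C lam\<^sup>2 q\<^sup>k) - 1\<close>
(\<open>qcoeff_scale_bound\<close>), and \<open>q\<^sup>n = exp (- \<pi> n / lam)\<close> is smaller than
\<open>exp (- M lam)\<close> for every \<open>M\<close> because \<open>n / lam\<^sup>2\<close> tends to infinity.  For \<open>k < n\<close> the
same bound only gives \<open>exp (C lam\<^sup>2)\<close>, but the Gaussian is then at most
\<open>exp (- \<pi> l n\<^sup>2 / (4 lam))\<close>, which wins for the same reason.  So, up to an error
\<open>exp (- M lam)\<close>, the sum may be replaced by the sum of the Gaussian over all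
integers, with or without signs (\<open>weighted_gauss_sum_approx\<close>).

The full sums are theta functions of a real argument, and Poisson summation
(\<open>gauss_sum_poisson\<close>) converts them into rapidly convergent cosine series in
\<open>exp (- \<pi> m\<^sup>2 / t)\<close>.  Without signs the term \<open>m = 0\<close> gives the main term and
\<open>m = \<plusminus>1\<close> the error \<open>exp (- \<pi> / t)\<close>.  With signs the frequencies become
half-integers (\<open>gauss_sum_alternating_poisson\<close>): \<open>\<plusminus>1/2\<close> give the factor
\<open>2 exp (- \<pi> / (4 t)) cos (\<pi> v / t)\<close> and \<open>\<plusminus>3/2\<close> a relative error
\<open>exp (- 2 \<pi> / t)\<close>.

Poisson summation rests on two facts: the cosine coefficients of the periodized
Gaussian unfold to the Fourier transform of the Gaussian over the line, and a
continuous function whose cosine coefficients over a period vanish is 0 at the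
midpoint (\<open>cos_moments_zero_imp_midpoint_zero\<close>).  The second fact, applied on
every translated period, replaces pointwise convergence of Fourier series.\<close>

section \<open>The Fourier transform of the Gaussian\<close>

text \<open>The real and imaginary parts of the characteristic function of the standard normal distribution.\<close>

lemma integral_std_normal_cos_sin:
  fixes s :: real
  shows "has_bochner_integral lborel (\<lambda>u. exp (-(u\<^sup>2/2)) * cos (s * u)) (sqrt (2*pi) * exp (-(s\<^sup>2/2)))"
    and "has_bochner_integral lborel (\<lambda>u. exp (-(u\<^sup>2/2)) * sin (s * u)) 0"
proof -
  have int: "integrable lborel (\<lambda>u. of_real (std_normal_density u) * iexp (s * u))"
    by (rule Bochner_Integration.integrable_bound[OF integrable_std_normal_moment[of 0]])
       (auto simp: norm_mult norm_divide std_normal_density_def simp del: of_real_mult)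
  have "char std_normal_distribution s = (CLINT u|lborel. of_real (std_normal_density u) * iexp (s * u))"
    unfolding char_def
    by (subst integral_density) (auto simp: scaleR_conv_of_real std_normal_density_def)
  then have v: "(CLINT u|lborel. of_real (std_normal_density u) * iexp (s * u)) = of_real (exp (-(s\<^sup>2/2)))"
    by (simp add: char_std_normal_distribution)
  have hb: "has_bochner_integral lborel (\<lambda>u. of_real (std_normal_density u) * iexp (s * u)) (of_real (exp (-(s\<^sup>2/2))))"
    using int v has_bochner_integral_integrable by metis
  have re: "has_bochner_integral lborel (\<lambda>u. sqrt (2*pi) * Re (of_real (std_normal_density u) * iexp (s * u))) (sqrt (2*pi) * Re (of_real (exp (-(s\<^sup>2/2)))))"
    by (intro has_bochner_integral_mult_right has_bochner_integral_bounded_linear[OF bounded_linear_Re hb])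
  have im: "has_bochner_integral lborel (\<lambda>u. sqrt (2*pi) * Im (of_real (std_normal_density u) * iexp (s * u))) (sqrt (2*pi) * Im (of_real (exp (-(s\<^sup>2/2)))))"
    by (intro has_bochner_integral_mult_right has_bochner_integral_bounded_linear[OF bounded_linear_Im hb])
  show "has_bochner_integral lborel (\<lambda>u. exp (-(u\<^sup>2/2)) * cos (s * u)) (sqrt (2*pi) * exp (-(s\<^sup>2/2)))"
    using re by (simp add: std_normal_density_def Re_exp mult.assoc)
  show "has_bochner_integral lborel (\<lambda>u. exp (-(u\<^sup>2/2)) * sin (s * u)) 0"
    using im by (simp add: std_normal_density_def Im_exp mult.assoc)
qed

text \<open>Substituting \<open>u = sqrt (2 \<pi> t) (x + y)\<close> reduces the claim to the standard normal case. The
shift by \<open>x\<close> becomes a phase, of which only the cosine part survives since the sine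
integral vanishes by oddness.\<close>

lemma gauss_fourier:
  fixes t x k :: real
  assumes "t > 0"
  shows "has_bochner_integral lborel (\<lambda>y. exp (- pi * t * (x + y)\<^sup>2) * cos (2 * pi * k * y))
           (exp (- pi * k\<^sup>2 / t) * cos (2 * pi * k * x) / sqrt t)"
proof -
  define c where "c = sqrt (2 * pi * t)"
  have c: "c > 0" "c\<^sup>2 = 2 * pi * t" "c = sqrt (2*pi) * sqrt t" using assms unfolding c_def real_sqrt_mult[of "2 * pi" t]
    by (simp_all add: power_mult_distrib)
  define s where "s = 2 * pi * k / c"
  have s2: "s\<^sup>2/2 = pi * k\<^sup>2 / t" using c assms by (simp add: s_def power_divide power_mult_distrib field_simps power2_eq_square)
  have "has_bochner_integral lborel
     (\<lambda>u. cos (2*pi*k*x) * (exp (-(u\<^sup>2/2)) * cos (s * u)) + sin (2*pi*k*x) * (exp (-(u\<^sup>2/2)) * sin (s * u)))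
     (cos (2*pi*k*x) * (sqrt (2*pi) * exp (-(s\<^sup>2/2))) + sin (2*pi*k*x) * 0)"
    by (intro has_bochner_integral_add has_bochner_integral_mult_right integral_std_normal_cos_sin)
  moreover have "(\<lambda>u. cos (2*pi*k*x) * (exp (-(u\<^sup>2/2)) * cos (s * u)) + sin (2*pi*k*x) * (exp (-(u\<^sup>2/2)) * sin (s * u)))
      = (\<lambda>u. exp (-(u\<^sup>2/2)) * cos (s * u - 2*pi*k*x))"
    by (auto simp: cos_diff algebra_simps)
  ultimately have A: "has_bochner_integral lborel (\<lambda>u. exp (-(u\<^sup>2/2)) * cos (s * u - 2*pi*k*x)) 
      (cos (2*pi*k*x) * (sqrt (2*pi) * exp (-(s\<^sup>2/2))))" by simp
  have "c \<noteq> 0" using c(1) by simp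
  moreover have "u /\<^sub>R \<bar>c\<bar> = u / c" for u :: real
    using c(1) by (simp add: divide_inverse_commute)
  ultimately
  have "has_bochner_integral lborel (\<lambda>y. exp (-((c*x + c*y)\<^sup>2/2)) * cos (s * (c*x + c*y) - 2*pi*k*x))
     (cos (2*pi*k*x) * (sqrt (2*pi) * exp (-(s\<^sup>2/2))) / c)"
    using lborel_has_bochner_integral_real_affine_iff[THEN iffD1, OF _ A, of c "c * x"] by simp
  moreover have "exp (-((c*x + c*y)\<^sup>2/2)) * cos (s * (c*x + c*y) - 2*pi*k*x) = exp (- pi * t * (x + y)\<^sup>2) * cos (2 * pi * k * y)" for y
  proof -
    have "(c*x + c*y)\<^sup>2/2 = pi * t * (x + y)\<^sup>2"
      using c(2) by (simp add: distrib_left[symmetric] power_mult_distrib)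
    moreover have "s * (c*x + c*y) - 2*pi*k*x = 2*pi*k*y" using \<open>c \<noteq> 0\<close> by (simp add: s_def field_simps)
    ultimately show ?thesis by simp
  qed
  moreover have "cos (2*pi*k*x) * (sqrt (2*pi) * exp (-(s\<^sup>2/2))) / c = exp (- pi * k\<^sup>2 / t) * cos (2 * pi * k * x) / sqrt t"
    unfolding s2 c(3) using assms by simp
  ultimately show ?thesis by simp
qed

section \<open>Uniqueness of cosine coefficients\<close>

text \<open>Induction on the power, trading each factor \<open>cos (2 \<pi> y)\<close> for a shift of the frequency by
\<open>\<plusminus>1\<close>; this is why the extra frequency \<open>m\<close> is carried along.\<close>

lemma cos_moments_zero_imp_cos_power_moments_zero:
  fixes D :: "real \<Rightarrow> real"
  assumes cont: "continuous_on {0..1} D"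
    and zero: "\<And>m::int. integral {0..1} (\<lambda>y. D y * cos (2 * pi * of_int m * y)) = 0"
  shows "integral {0..1} (\<lambda>y. D y * cos (2 * pi * y) ^ N * cos (2 * pi * of_int m * y)) = 0"
proof (induction N arbitrary: m)
  case 0
  then show ?case using zero by simp
next
  case (Suc N)
  let ?I = "\<lambda>m y. D y * cos (2 * pi * y) ^ N * cos (2 * pi * of_int m * y)"
  have int: "?I k integrable_on {0..1}" for k :: int
    by (intro integrable_continuous_interval continuous_intros cont)
  have eq: "(\<lambda>y. D y * cos (2 * pi * y) ^ Suc N * cos (2 * pi * of_int m * y)) =
        (\<lambda>y. (?I (m + 1) y + ?I (m - 1) y) / 2)"
  proof
    fix y
    have e: "2 * pi * of_int (m + 1) * y = 2 * pi * of_int m * y + 2 * pi * y"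
      "2 * pi * of_int (m - 1) * y = 2 * pi * of_int m * y - 2 * pi * y"
      by (simp_all add: algebra_simps)
    show "D y * cos (2 * pi * y) ^ Suc N * cos (2 * pi * of_int m * y) = (?I (m + 1) y + ?I (m - 1) y) / 2"
      unfolding e cos_add cos_diff by (simp add: field_simps)
  qed
  show ?case
    unfolding eq integral_divide
    using integral_add[OF int int, of "m + 1" "m - 1"] Suc.IH[of "m + 1"] Suc.IH[of "m - 1"] by simp
qed

text \<open>The functions of \<open>cos (2 \<pi> y)\<close> on the unit interval are the ones symmetric about \<open>1/2\<close>,
and by Weierstrass they are uniform limits of polynomials in \<open>cos (2 \<pi> y)\<close>. Hence \<open>D\<close> is
orthogonal to every continuous symmetric function, in particular to its own
symmetrization \<open>E y = D y + D (1 - y)\<close>. Twice that inner product is the integral of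
\<open>E\<^sup>2\<close>, so \<open>E\<close> vanishes, and \<open>E (1/2) = 2 D (1/2)\<close>. The midpoint is singled out
as the common centre of symmetry of the cosines.\<close>

lemma cos_moments_zero_imp_midpoint_zero:
  fixes D :: "real \<Rightarrow> real"
  assumes cont: "continuous_on {0..1} D"
    and zero: "\<And>m::int. integral {0..1} (\<lambda>y. D y * cos (2 * pi * of_int m * y)) = 0"
  shows "D (1/2) = 0"
proof -
  define E where "E = (\<lambda>y. D y + D (1 - y))"
  have contR: "continuous_on {0..1} (\<lambda>y. D (1 - y))"
    by (rule continuous_on_compose2[OF cont]) (auto intro!: continuous_intros)
  have contE: "continuous_on {0..1} E"
    unfolding E_def by (intro continuous_intros cont contR)
  \<comment> \<open>\<open>E\<close> as a function of \<open>c = cos (2 \<pi> y)\<close>\<close>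
  define H where "H = (\<lambda>c. E (arccos c / (2 * pi)))"
  have ac: "arccos c / (2 * pi) \<in> {0..1}" if "c \<in> {-1..1}" for c
    using arccos_lbound[of c] arccos_ubound[of c] that by (auto simp: field_simps)
  have contH: "continuous_on {-1..1} H"
    unfolding H_def
    by (rule continuous_on_compose2[OF contE]) (use ac in \<open>auto intro!: continuous_intros\<close>)
  have HE: "H (cos (2 * pi * y)) = E y" if "y \<in> {0..1}" for y
  proof (cases "y \<le> 1/2")
    case True
    then have "arccos (cos (2 * pi * y)) = 2 * pi * y"
      using that by (intro arccos_cos) auto
    then show ?thesis by (simp add: H_def)
  next
    case False
    have "cos (2 * pi * y) = cos (2 * pi * (1 - y))"
      by (simp add: right_diff_distrib cos_diff)
    moreover have "arccos (cos (2 * pi * (1 - y))) = 2 * pi * (1 - y)"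
      using that False by (intro arccos_cos) auto
    ultimately show ?thesis by (simp add: H_def E_def)
  qed
  have poly: "integral {0..1} (\<lambda>y. D y * p (cos (2 * pi * y))) = 0" 
    if "real_polynomial_function p" for p
  proof -
    obtain a n where p: "p = (\<lambda>x. \<Sum>i\<le>n. a i * x ^ i)"
      using \<open>real_polynomial_function p\<close> real_polynomial_function_iff_sum by auto
    have int: "(\<lambda>y. a i * (D y * cos (2 * pi * y) ^ i)) integrable_on {0..1}" for i
      by (intro integrable_continuous_interval continuous_intros cont)
    have "(\<lambda>y. D y * p (cos (2 * pi * y))) = (\<lambda>y. \<Sum>i\<le>n. a i * (D y * cos (2 * pi * y) ^ i))"
      by (simp add: p sum_distrib_left mult_ac)
    then show ?thesis
      using int cos_moments_zero_imp_cos_power_moments_zero[OF cont zero, of _ 0] 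
      by (simp add: integral_sum)
  qed
  obtain M where M: "M > 0" "\<And>y. y \<in> {0..1} \<Longrightarrow> \<bar>D y\<bar> \<le> M"
  proof -
    have "bounded (D ` {0..1})" by (intro compact_imp_bounded compact_continuous_image cont) auto
    then show ?thesis using that unfolding bounded_pos by auto
  qed
  have intDE: "(\<lambda>y. D y * E y) integrable_on {0..1}"
    by (intro integrable_continuous_interval continuous_intros cont contE)
  have DE: "integral {0..1} (\<lambda>y. D y * E y) = 0"
  proof -
    have "\<bar>integral {0..1} (\<lambda>y. D y * E y)\<bar> \<le> M * e" if e: "e > 0" for e
    proof -
      obtain p where p: "real_polynomial_function p" "\<And>x. x \<in> {-1..1} \<Longrightarrow> \<bar>H x - p x\<bar> < e"
        using Stone_Weierstrass_real_polynomial_function[OF _ contH e] by auto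
      have contp: "continuous_on A p" for A
        using p(1) by (simp add: continuous_on_polymonial_function real_polynomial_function_eq)
      have contpc: "continuous_on {0..1} (\<lambda>y. D y * p (cos (2 * pi * y)))"
        by (intro continuous_intros cont continuous_on_compose2[OF contp[of UNIV]]) auto
      have "integral {0..1} (\<lambda>y. D y * E y) = integral {0..1} (\<lambda>y. D y * E y - D y * p (cos (2 * pi * y)))"
        using poly[OF p(1)] intDE integrable_continuous_interval[OF contpc] by (subst integral_diff) auto
      also have "norm \<dots> \<le> (M * e) * (1 - 0)"
      proof (rule integral_bound)
        show "continuous_on {0..1} (\<lambda>y. D y * E y - D y * p (cos (2 * pi * y)))"
          by (intro continuous_on_diff contpc continuous_on_mult cont contE)
        fix y :: real assume y: "y \<in> {0..1}"
        have "\<bar>D y * (H (cos (2 * pi * y)) - p (cos (2 * pi * y)))\<bar> \<le> M * e"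
          unfolding abs_mult using M y p(2)[of "cos (2 * pi * y)"] by (intro mult_mono) auto
        then show "norm (D y * E y - D y * p (cos (2 * pi * y))) \<le> M * e"
          using HE[OF y] by (simp add: algebra_simps)
      qed auto
      finally show ?thesis by simp
    qed
    from this[of "\<bar>integral {0..1} (\<lambda>y. D y * E y)\<bar> / (2 * M)"] M(1) show ?thesis
      by (auto simp: field_simps)
  qed
  have "((\<lambda>y. D (1 - y) * E y) has_integral 0) {0..1}"
  proof -
    have "((\<lambda>y. D y * E y) has_integral 0) {0..1}" using DE intDE by (simp add: has_integral_iff)
    from has_integral_affinity[OF this[folded cbox_interval], of "-1" 1]
    have "((\<lambda>y. D (1 - y) * E (1 - y)) has_integral 0) ((\<lambda>y. 1 - y) ` {0..1})"
      by simp
    then show ?thesis by (simp add: E_def add.commute image_diff_atLeastAtMost)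
  qed
  then have "((\<lambda>y. D y * E y + D (1 - y) * E y) has_integral 0 + 0) {0..1}"
    using DE intDE by (intro has_integral_add) (auto simp: has_integral_iff)
  moreover have "(\<lambda>y. D y * E y + D (1 - y) * E y) = (\<lambda>y. (E y)\<^sup>2)"
    by (auto simp: E_def power2_eq_square algebra_simps)
  ultimately have "integral {0..1} (\<lambda>y. (E y)\<^sup>2) = 0"
    by (simp add: has_integral_iff)
  then have "(E (1/2))\<^sup>2 = 0"
    using integral_eq_0_iff[of 0 1 "\<lambda>y. (E y)\<^sup>2"] continuous_on_power[OF contE] by auto
  then show ?thesis by (simp add: E_def)
qed

section \<open>Periodized Gaussians and Poisson summation\<close>

definition gauss :: "real \<Rightarrow> real \<Rightarrow> real" where
  "gauss t y = exp (- pi * t * y\<^sup>2)"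

text \<open>The sum of \<open>gauss t (x + j)\<close> over all integers \<open>j\<close>; pairing \<open>j = n\<close> with
\<open>j = - n - 1\<close> makes it an ordinary series whose partial sums cover the symmetric blocks
\<open>- N \<le> j < N\<close>.\<close>

definition gauss_sum :: "real \<Rightarrow> real \<Rightarrow> real" where
  "gauss_sum t x = (\<Sum>n. gauss t (x + real n) + gauss t (x - real n - 1))"

lemma gauss_nonneg: "gauss t y \<ge> 0"
  by (simp add: gauss_def)

lemma gauss_minus [simp]: "gauss t (- y) = gauss t y"
  by (simp add: gauss_def)

lemma continuous_on_gauss: "continuous_on A f \<Longrightarrow> continuous_on A (\<lambda>y. gauss t (f y))"
  unfolding gauss_def by (intro continuous_intros)

text \<open>From \<open>(s + n)\<^sup>2 + s\<^sup>2 \<ge> n\<^sup>2 / 2\<close>: a geometric majorant, uniform for \<open>s\<close> in a bounded set.\<close>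

lemma gauss_shift_le:
  assumes "t > 0" "\<bar>s\<bar> \<le> B"
  shows "gauss t (s + real n) \<le> exp (pi * t * B\<^sup>2) * exp (- pi * t / 2) ^ n"
proof -
  have "(s + real n)\<^sup>2 + s\<^sup>2 \<ge> (real n)\<^sup>2 / 2"
    using sum_squares_ge_zero[of "2 * s + real n" 0] by (simp add: power2_eq_square algebra_simps)
  moreover have "s\<^sup>2 \<le> B\<^sup>2" using assms(2) abs_le_square_iff[of s B] by simp
  moreover have "(real n)\<^sup>2 \<ge> real n"
    by (cases n) (auto simp: power2_eq_square)
  ultimately have "real n / 2 - B\<^sup>2 \<le> (s + real n)\<^sup>2" by linarith
  then have "pi * t * (real n / 2 - B\<^sup>2) \<le> pi * t * (s + real n)\<^sup>2"
    using assms(1) by (intro mult_left_mono) auto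
  then show ?thesis
    by (simp add: gauss_def exp_of_nat_mult[symmetric] exp_add[symmetric] algebra_simps)
qed

lemma summable_gauss_bound:
  fixes t :: real assumes "t > 0"
  shows "summable (\<lambda>n. C * exp (- pi * t / 2) ^ n)"
  using assms by (intro summable_mult summable_geometric) auto

lemma summable_gauss:
  assumes "t > 0" shows "summable (\<lambda>n. gauss t (x + real n))"
  by (rule summable_comparison_test'[OF summable_gauss_bound[OF assms, of "exp (pi * t * \<bar>x\<bar>\<^sup>2)"], of 0])
     (use gauss_shift_le[OF assms, of x "\<bar>x\<bar>"] in \<open>auto simp: gauss_nonneg\<close>)

lemma gauss_reflect: "gauss t (x - real n - 1) = gauss t ((1 - x) + real n)"
  using gauss_minus[of t "x - real n - 1"] by (simp add: algebra_simps)

lemma summable_gauss':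
  assumes "t > 0" shows "summable (\<lambda>n. gauss t (x - real n - 1))"
  unfolding gauss_reflect by (rule summable_gauss[OF assms])

lemma M_test_sums_integral:
  fixes f :: "nat \<Rightarrow> real \<Rightarrow> real"
  assumes cont: "\<And>n. continuous_on {a..b} (f n)"
    and le: "\<And>n y. y \<in> {a..b} \<Longrightarrow> \<bar>f n y\<bar> \<le> M n" and sum: "summable M"
  shows "continuous_on {a..b} (\<lambda>y. \<Sum>n. f n y)"
    and "(\<lambda>n. integral {a..b} (f n)) sums integral {a..b} (\<lambda>y. \<Sum>n. f n y)"
proof -
  have u: "uniform_limit {a..b} (\<lambda>n y. \<Sum>i<n. f i y) (\<lambda>y. \<Sum>n. f n y) sequentially"
    by (rule Weierstrass_m_test[OF _ sum]) (use le in auto)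
  have c: "continuous_on {a..b} (\<lambda>y. \<Sum>i<n. f i y)" for n
    by (intro continuous_on_sum cont)
  show "continuous_on {a..b} (\<lambda>y. \<Sum>n. f n y)"
    by (rule uniform_limit_theorem[OF _ u]) (use c in auto)
  obtain I J where IJ: "\<And>n. ((\<lambda>y. \<Sum>i<n. f i y) has_integral I n) {a..b}"
      "((\<lambda>y. \<Sum>n. f n y) has_integral J) {a..b}" "I \<longlonglongrightarrow> J"
    using uniform_limit_integral[OF u c] by auto
  have "I n = (\<Sum>i<n. integral {a..b} (f i))" for n
    using IJ(1)[of n] integral_sum[of "{..<n}" f "{a..b}"] integrable_continuous_interval[OF cont]
    by (simp add: has_integral_iff)
  then have "I = (\<lambda>n. \<Sum>i<n. integral {a..b} (f i))" by auto
  then show "(\<lambda>n. integral {a..b} (f n)) sums integral {a..b} (\<lambda>y. \<Sum>n. f n y)"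
    using IJ(2,3) by (simp add: sums_def has_integral_iff)
qed

lemma M_test_sums_integral_mult:
  fixes f :: "nat \<Rightarrow> real \<Rightarrow> real"
  assumes cont: "\<And>n. continuous_on {a..b} (f n)"
    and le: "\<And>n y. y \<in> {a..b} \<Longrightarrow> \<bar>f n y\<bar> \<le> M n" and sum: "summable M"
    and g: "continuous_on {a..b} g" "\<And>y. \<bar>g y\<bar> \<le> 1"
  shows "(\<lambda>n. integral {a..b} (\<lambda>y. f n y * g y)) sums integral {a..b} (\<lambda>y. (\<Sum>n. f n y) * g y)"
proof -
  have "summable (\<lambda>n. f n y)" if "y \<in> {a..b}" for y
    by (rule summable_comparison_test'[OF sum, of 0]) (use le that in auto)
  then have "integral {a..b} (\<lambda>y. \<Sum>n. f n y * g y) = integral {a..b} (\<lambda>y. (\<Sum>n. f n y) * g y)"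
    by (intro integral_cong) (simp add: suminf_mult2)
  moreover have "\<bar>f n y * g y\<bar> \<le> M n" if "y \<in> {a..b}" for n y
    using mult_mono[OF le[OF that, of n] g(2)[of y]] le[OF that, of n] by (simp add: abs_mult)
  ultimately show ?thesis
    using M_test_sums_integral(2)[of a b "\<lambda>n y. f n y * g y" M] cont g(1) sum
    by (simp add: continuous_on_mult)
qed

lemma integral_unit_shift:
  fixes h :: "real \<Rightarrow> real"
  assumes "continuous_on UNIV h"
  shows "integral {0..1} (\<lambda>y. h (y + c)) = integral {c..c+1} h"
proof -
  have "(h has_integral integral {c..c+1} h) (cbox c (c+1))"
    using assms continuous_on_subset by (auto intro!: integrable_integral integrable_continuous_interval)
  from has_integral_affinity'[OF this, of 1 c] show ?thesis by (simp add: has_integral_iff)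
qed

lemma integral_symmetric_tendsto:
  fixes h :: "real \<Rightarrow> real"
  assumes "has_bochner_integral lborel h I"
  shows "(\<lambda>N::nat. integral {- real N..real N} h) \<longlonglongrightarrow> I"
proof -
  have int: "integrable lborel h" and I: "integral\<^sup>L lborel h = I"
    using assms by (auto simp: has_bochner_integral_iff)
  have "(\<lambda>N::nat. integral\<^sup>L lborel (\<lambda>y. indicator {- real N..real N} y *\<^sub>R h y)) \<longlonglongrightarrow> integral\<^sup>L lborel h"
  proof (rule integral_dominated_convergence)
    show "integrable lborel (\<lambda>y. norm (h y))" using int by simp
    show "AE y in lborel. (\<lambda>N. indicator {- real N..real N} y *\<^sub>R h y) \<longlonglongrightarrow> h y"
    proof (rule AE_I2)
      fix y
      obtain N0 :: nat where "\<bar>y\<bar> \<le> real N0" using real_arch_simple by blast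
      then have "eventually (\<lambda>N. indicator {- real N..real N} y *\<^sub>R h y = h y) sequentially"
        by (intro eventually_sequentiallyI[of N0]) (auto simp: indicator_def)
      then show "(\<lambda>N. indicator {- real N..real N} y *\<^sub>R h y) \<longlonglongrightarrow> h y"
        by (rule tendsto_eventually)
    qed
  qed (use int in \<open>auto simp: indicator_def\<close>)
  moreover have "integral\<^sup>L lborel (\<lambda>y. indicator {- real N..real N} y *\<^sub>R h y) = integral {- real N..real N} h" for N
    using set_borel_integral_eq_integral(2)[of "{- real N..real N}" h]
      integrable_mult_indicator[OF _ int, of "{- real N..real N}"]
    by (simp add: set_lebesgue_integral_def set_integrable_def)
  ultimately show ?thesis using I by simp
qed

text \<open>The unfolding step. The \<open>n\<close>-th paired term contributes the integrals over \<open>[n, n + 1]\<close> and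
\<open>[- n - 1, - n]\<close>, because the cosine has period 1; the partial sums are therefore integrals
over \<open>[- N, N]\<close> and tend to the integral over the line.\<close>

lemma gauss_sum_cos_moment:
  fixes k :: int
  assumes t: "t > 0"
  shows "continuous_on {0..1} (\<lambda>y. gauss_sum t (x + y))"
    and "integral {0..1} (\<lambda>y. gauss_sum t (x + y) * cos (2 * pi * of_int k * y)) =
         exp (- pi * (of_int k)\<^sup>2 / t) * cos (2 * pi * of_int k * x) / sqrt t"
proof -
  define B where "B = \<bar>x\<bar> + 2"
  let ?f = "\<lambda>n y. gauss t (x + y + real n) + gauss t (x + y - real n - 1)"
  let ?M = "\<lambda>n. (2 * exp (pi * t * B\<^sup>2)) * exp (- pi * t / 2) ^ n"
  have cont: "continuous_on A (?f n)" for n A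
    by (intro continuous_intros continuous_on_gauss)
  have le: "\<bar>?f n y\<bar> \<le> ?M n" if "y \<in> {0..1}" for n y
  proof -
    have "\<bar>x + y\<bar> \<le> B" "\<bar>1 - (x + y)\<bar> \<le> B" using that by (auto simp: B_def)
    then show ?thesis
      using gauss_shift_le[OF t, of "x + y" B n] gauss_shift_le[OF t, of "1 - (x + y)" B n]
        gauss_nonneg[of t "x + y + real n"] gauss_nonneg[of t "x + y - real n - 1"]
      by (simp add: gauss_reflect)
  qed
  show "continuous_on {0..1} (\<lambda>y. gauss_sum t (x + y))"
    unfolding gauss_sum_def by (rule M_test_sums_integral(1)[OF cont le summable_gauss_bound[OF t]])
  define h where "h = (\<lambda>y. gauss t (x + y) * cos (2 * pi * of_int k * y))"
  have conth: "continuous_on A h" for A unfolding h_def by (intro continuous_intros continuous_on_gauss)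
  have inth: "h integrable_on {a..b}" for a b by (rule integrable_continuous_interval[OF conth])
  have periodic: "cos (2 * pi * of_int k * (y + of_int j)) = cos (2 * pi * of_int k * y)" for y and j :: int
  proof -
    have "2 * pi * of_int k * (y + of_int j) = 2 * pi * of_int k * y + 2 * pi * of_int (k * j)"
      by (simp add: algebra_simps)
    then show ?thesis by (simp only: cos_add cos_int_2pin sin_int_2pin mult_1_right mult_zero_right diff_zero)
  qed
  have piece: "integral {0..1} (\<lambda>y. ?f n y * cos (2 * pi * of_int k * y)) =
      integral {real n..real n + 1} h + integral {- real n - 1..- real n} h" for n
  proof -
    have "(\<lambda>y. ?f n y * cos (2 * pi * of_int k * y)) = (\<lambda>y. h (y + real n) + h (y + (- real n - 1)))"
      using periodic[of _ "int n"] periodic[of _ "- int n - 1"] 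
      by (auto simp: h_def algebra_simps)
    moreover have "(\<lambda>y. h (y + c)) integrable_on {0..1}" for c
      by (intro integrable_continuous_interval continuous_on_compose2[OF conth[of UNIV]] continuous_intros) auto
    ultimately show ?thesis
      using integral_unit_shift[OF conth, of "real n"] integral_unit_shift[OF conth, of "- real n - 1"]
      by (simp add: integral_add)
  qed
  have partial: "(\<Sum>n<N. integral {0..1} (\<lambda>y. ?f n y * cos (2 * pi * of_int k * y))) = integral {- real N..real N} h" for N
  proof (induction N)
    case (Suc N)
    have "integral {- real (Suc N)..real (Suc N)} h =
        integral {- real (Suc N)..- real N} h + integral {- real N..real (Suc N)} h"
      by (rule Henstock_Kurzweil_Integration.integral_combine[symmetric]) (auto intro: inth)
    also have "integral {- real N..real (Suc N)} h = integral {- real N..real N} h + integral {real N..real (Suc N)} h"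
      by (rule Henstock_Kurzweil_Integration.integral_combine[symmetric]) (auto intro: inth)
    finally have "integral {- real (Suc N)..real (Suc N)} h = integral {- real (Suc N)..- real N} h +
        (integral {- real N..real N} h + integral {real N..real (Suc N)} h)" .
    moreover have "{- real (Suc N)..- real N} = {- real N - 1..- real N}" "{real N..real (Suc N)} = {real N..real N + 1}"
      by auto
    ultimately show ?case
      unfolding sum.lessThan_Suc Suc.IH unfolding piece by (simp only: add.commute add.left_commute)
  qed auto
  have "has_bochner_integral lborel h (exp (- pi * (of_int k)\<^sup>2 / t) * cos (2 * pi * of_int k * x) / sqrt t)"
    unfolding h_def gauss_def by (rule gauss_fourier[OF t])
  from integral_symmetric_tendsto[OF this]
  have "(\<lambda>n. integral {0..1} (\<lambda>y. ?f n y * cos (2 * pi * of_int k * y))) sums (exp (- pi * (of_int k)\<^sup>2 / t) * cos (2 * pi * of_int k * x) / sqrt t)"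
    unfolding sums_def partial .
  moreover have "(\<lambda>n. integral {0..1} (\<lambda>y. ?f n y * cos (2 * pi * of_int k * y))) sums integral {0..1} (\<lambda>y. gauss_sum t (x + y) * cos (2 * pi * of_int k * y))"
    unfolding gauss_sum_def by (rule M_test_sums_integral_mult[OF cont le summable_gauss_bound[OF t]]) (auto intro!: continuous_intros)
  ultimately show "integral {0..1} (\<lambda>y. gauss_sum t (x + y) * cos (2 * pi * of_int k * y)) =
         exp (- pi * (of_int k)\<^sup>2 / t) * cos (2 * pi * of_int k * x) / sqrt t"
    by (rule sums_unique2[symmetric])
qed

lemma integral_cos_period:
  fixes k :: int
  shows "integral {0..1} (\<lambda>y. cos (2 * pi * of_int k * y + a)) = (if k = 0 then cos a else 0)"
proof (cases "k = 0")
  case False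
  have "((\<lambda>y. cos (2 * pi * of_int k * y + a)) has_integral
      sin (2 * pi * of_int k * 1 + a) / (2 * pi * of_int k) - sin (2 * pi * of_int k * 0 + a) / (2 * pi * of_int k)) {0..1}"
    by (rule fundamental_theorem_of_calculus)
       (use False in \<open>auto intro!: derivative_eq_intros simp: has_real_derivative_iff_has_vector_derivative[symmetric]\<close>)
  moreover have "sin (2 * pi * of_int k * 1 + a) = sin a"
    by (simp only: sin_add mult_1_right cos_int_2pin sin_int_2pin mult_zero_left mult_1_left add_0)
  ultimately show ?thesis using False by (simp add: has_integral_iff)
qed simp

text \<open>Orthogonality. The series below starts at frequency \<open>Suc m\<close>, so the index that
matches frequency \<open>k\<close> is \<open>\<bar>k\<bar> - 1\<close>.\<close>

lemma integral_cos_mult_cos: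
  fixes k :: int
  shows "integral {0..1} (\<lambda>y. cos (2 * pi * real (Suc m) * (x + y)) * cos (2 * pi * of_int k * y)) =
    (if m = nat (\<bar>k\<bar> - 1) \<and> k \<noteq> 0 then cos (2 * pi * of_int k * x) / 2 else 0)"
proof -
  define M where "M = int (Suc m)"
  let ?a = "2 * pi * of_int M * x"
  have e: "(\<lambda>y. cos (2 * pi * real (Suc m) * (x + y)) * cos (2 * pi * of_int k * y)) =
     (\<lambda>y. (cos (2 * pi * of_int (M - k) * y + ?a) + cos (2 * pi * of_int (M + k) * y + ?a)) / 2)"
  proof
    fix y
    have "cos (2 * pi * real (Suc m) * (x + y)) * cos (2 * pi * of_int k * y) =
      (cos (2 * pi * real (Suc m) * (x + y) - 2 * pi * of_int k * y) + cos (2 * pi * real (Suc m) * (x + y) + 2 * pi * of_int k * y)) / 2"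
      by (rule cos_times_cos)
    then show "cos (2 * pi * real (Suc m) * (x + y)) * cos (2 * pi * of_int k * y) = 
      (cos (2 * pi * of_int (M - k) * y + ?a) + cos (2 * pi * of_int (M + k) * y + ?a)) / 2"
      by (simp add: M_def algebra_simps)
  qed
  have "integral {0..1} (\<lambda>y. cos (2 * pi * of_int (M - k) * y + ?a) + cos (2 * pi * of_int (M + k) * y + ?a)) =
    (if M = k then cos ?a else 0) + (if M = - k then cos ?a else 0)"
    by (subst integral_add)
       (auto intro!: integrable_continuous_interval continuous_intros simp: integral_cos_period simp del: of_int_diff of_int_add)
  moreover have "m = nat (\<bar>k\<bar> - 1) \<and> k \<noteq> 0 \<longleftrightarrow> M = k \<or> M = - k" by (auto simp: M_def)
  moreover have "\<not> (M = k \<and> M = - k)" by (auto simp: M_def)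
  moreover have "cos ?a = cos (2 * pi * of_int k * x)" if "M = - k" 
    using cos_minus[of ?a] that by simp
  ultimately show ?thesis unfolding e integral_divide by auto
qed

lemma gauss_coeff_le:
  assumes "t > 0" shows "exp (- pi * (real (Suc m))\<^sup>2 / t) \<le> exp (- pi / t) ^ Suc m"
proof -
  have "pi / t * real (Suc m) \<le> pi / t * (real (Suc m))\<^sup>2"
    using assms by (intro mult_left_mono) (auto simp: power2_eq_square)
  then show ?thesis
    unfolding exp_of_nat_mult[symmetric] by (simp add: algebra_simps)
qed

lemma summable_gauss_coeff_bound:
  assumes "t > (0::real)" shows "summable (\<lambda>m. exp (- pi / t) ^ Suc m)"
proof -
  have "summable (\<lambda>m. exp (- pi / t) ^ m)" using assms by (intro summable_geometric) (auto simp: divide_neg_pos)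
  then show ?thesis by (simp only: summable_Suc_iff)
qed

lemma gauss_coeff_cos_le:
  assumes "t > 0" 
  shows "\<bar>exp (- pi * (real (Suc m))\<^sup>2 / t) * cos u\<bar> \<le> exp (- pi / t) ^ Suc m"
proof -
  have "\<bar>exp (- pi * (real (Suc m))\<^sup>2 / t) * cos u\<bar> \<le> exp (- pi * (real (Suc m))\<^sup>2 / t) * 1"
    unfolding abs_mult by (intro mult_mono) auto
  then show ?thesis using gauss_coeff_le[OF assms, of m] by linarith
qed

lemma summable_gauss_coeff_cos:
  assumes "t > 0"
  shows "summable (\<lambda>m. exp (- pi * (real (Suc m))\<^sup>2 / t) * cos (u m))"
  by (rule summable_comparison_test'[OF summable_gauss_coeff_bound[OF assms], of 0])
     (use gauss_coeff_cos_le[OF assms] in auto)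

text \<open>Both sides are continuous in \<open>x\<close> and, as functions of \<open>y\<close> with \<open>x - 1/2 + y\<close> in place of
\<open>x\<close>, have the same cosine coefficients over the unit interval. Hence they agree at \<open>y = 1/2\<close>.\<close>

theorem gauss_sum_poisson:
  assumes t: "t > 0"
  shows "gauss_sum t x = (1 + 2 * (\<Sum>m. exp (- pi * (real (Suc m))\<^sup>2 / t) * cos (2 * pi * real (Suc m) * x))) / sqrt t"
proof -
  \<comment> \<open>places the point \<open>x\<close> at the midpoint of the period\<close>
  define x' where "x' = x - 1/2"
  define S where "S = (\<lambda>x. \<Sum>m. exp (- pi * (real (Suc m))\<^sup>2 / t) * cos (2 * pi * real (Suc m) * x))"
  define D where "D = (\<lambda>y. gauss_sum t (x' + y) - (1 + 2 * S (x' + y)) / sqrt t)"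
  let ?f = "\<lambda>m y. exp (- pi * (real (Suc m))\<^sup>2 / t) * cos (2 * pi * real (Suc m) * (x' + y))"
  have cont: "continuous_on A (?f m)" for m A by (intro continuous_intros)
  note bound = gauss_coeff_cos_le[OF t] and summ = summable_gauss_coeff_bound[OF t]
  have contS: "continuous_on {0..1} (\<lambda>y. S (x' + y))"
    unfolding S_def by (rule M_test_sums_integral(1)[OF cont bound summ])
  have contD: "continuous_on {0..1} D"
    unfolding D_def using t by (intro continuous_intros gauss_sum_cos_moment(1) contS) auto
  have momS: "integral {0..1} (\<lambda>y. S (x' + y) * cos (2 * pi * of_int k * y)) =
     (if k = 0 then 0 else exp (- pi * (of_int k)\<^sup>2 / t) * cos (2 * pi * of_int k * x') / 2)" for k :: int
  proof -
    let ?c = "if k = 0 then 0 else exp (- pi * (of_int k)\<^sup>2 / t) * cos (2 * pi * of_int k * x') / 2"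
    have "(\<lambda>m. integral {0..1} (\<lambda>y. ?f m y * cos (2 * pi * of_int k * y))) sums 
        integral {0..1} (\<lambda>y. S (x' + y) * cos (2 * pi * of_int k * y))"
      unfolding S_def by (rule M_test_sums_integral_mult[OF cont bound summ]) (intro continuous_intros, simp)
    moreover have "integral {0..1} (\<lambda>y. ?f m y * cos (2 * pi * of_int k * y)) = (if m = nat (\<bar>k\<bar> - 1) then ?c else 0)" for m
    proof -
      have "real (Suc m) = \<bar>of_int k\<bar>" if "m = nat (\<bar>k\<bar> - 1)" "k \<noteq> 0" using that by auto
      then have "(real (Suc m))\<^sup>2 = (of_int k)\<^sup>2" if "m = nat (\<bar>k\<bar> - 1)" "k \<noteq> 0" using that by (metis power2_abs)
      then show ?thesis unfolding mult.assoc[of "exp _"] integral_mult_right integral_cos_mult_cos by auto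
    qed
    ultimately have "(\<lambda>m. if m = nat (\<bar>k\<bar> - 1) then ?c else 0) sums integral {0..1} (\<lambda>y. S (x' + y) * cos (2 * pi * of_int k * y))"
      by simp
    then show ?thesis by (rule sums_unique2[OF _ sums_single])
  qed
  have "D (1/2) = 0"
  proof (rule cos_moments_zero_imp_midpoint_zero[OF contD])
    fix k :: int
    let ?c = "\<lambda>y. cos (2 * pi * of_int k * y)"
    have i: "(\<lambda>y. gauss_sum t (x' + y) * ?c y) integrable_on {0..1}" "(\<lambda>y. S (x' + y) * ?c y) integrable_on {0..1}"
       "?c integrable_on {0..1}"
      by (intro integrable_continuous_interval continuous_intros gauss_sum_cos_moment(1) contS t)+
    have c: "integral {0..1} ?c = (if k = 0 then 1 else 0)" using integral_cos_period[of k 0] by simp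
    have "((\<lambda>y. gauss_sum t (x' + y) * ?c y - (?c y + 2 * (S (x' + y) * ?c y)) / sqrt t) has_integral
       exp (- pi * (of_int k)\<^sup>2 / t) * cos (2 * pi * of_int k * x') / sqrt t - (integral {0..1} ?c + 2 * integral {0..1} (\<lambda>y. S (x' + y) * ?c y)) / sqrt t) {0..1}"
      using i gauss_sum_cos_moment(2)[OF t, of x' k]
      by (intro has_integral_diff has_integral_divide has_integral_add has_integral_mult_right) (auto simp: has_integral_iff)
    moreover have "(\<lambda>y. gauss_sum t (x' + y) * ?c y - (?c y + 2 * (S (x' + y) * ?c y)) / sqrt t) = (\<lambda>y. D y * ?c y)"
      by (auto simp: D_def field_simps)
    moreover have "exp (- pi * (of_int k)\<^sup>2 / t) * cos (2 * pi * of_int k * x') / sqrt t - (integral {0..1} ?c + 2 * integral {0..1} (\<lambda>y. S (x' + y) * ?c y)) / sqrt t = 0"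
      unfolding c momS by auto
    ultimately show "integral {0..1} (\<lambda>y. D y * ?c y) = 0" by (simp add: has_integral_iff)
  qed
  then show ?thesis by (simp add: D_def x'_def S_def)
qed

lemma gauss_sums:
  assumes "t > 0"
  shows "(\<lambda>n. gauss t (x + real n) + gauss t (x - real n - 1)) sums gauss_sum t x"
  unfolding gauss_sum_def by (intro summable_sums summable_add summable_gauss summable_gauss' assms)

lemma sums_even_iff:
  fixes f :: "nat \<Rightarrow> real"
  shows "(\<lambda>n. if even n then f n else 0) sums s \<longleftrightarrow> (\<lambda>n. f (2 * n)) sums s"
proof -
  have "(\<lambda>n. if even (2 * n) then f (2 * n) else 0) sums s \<longleftrightarrow> (\<lambda>n. if even n then f n else 0) sums s"
  proof (rule sums_mono_reindex)
    fix n :: nat assume "n \<notin> range (\<lambda>n. 2 * n)"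
    then have "odd n" by (blast elim: evenE)
    then show "(if even n then f n else 0) = 0" by simp
  qed (simp add: strict_mono_def)
  then show ?thesis by simp
qed

lemma sums_odd_iff:
  fixes f :: "nat \<Rightarrow> real"
  shows "(\<lambda>n. if odd n then f n else 0) sums s \<longleftrightarrow> (\<lambda>n. f (2 * n + 1)) sums s"
proof -
  have "(\<lambda>n. if odd (2 * n + 1) then f (2 * n + 1) else 0) sums s \<longleftrightarrow> (\<lambda>n. if odd n then f n else 0) sums s"
  proof (rule sums_mono_reindex)
    fix n :: nat assume "n \<notin> range (\<lambda>n. 2 * n + 1)"
    then have "even n" by (metis (lifting) oddE rangeI)
    then show "(if odd n then f n else 0) = 0" by simp
  qed (simp add: strict_mono_def)
  then show ?thesis by simp
qed

lemma sums_alternating: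
  fixes f :: "nat \<Rightarrow> real"
  assumes "f sums a" "(\<lambda>n. f (2 * n)) sums b"
  shows "(\<lambda>n. (-1) ^ n * f n) sums (2 * b - a)"
proof -
  have "(\<lambda>n. if even n then f n else 0) sums b" using assms(2) by (simp only: sums_even_iff)
  from sums_diff[OF sums_mult[OF this, of 2] assms(1)]
  show ?thesis by (rule subst[where P = "\<lambda>f. f sums _", rotated]) (auto simp: fun_eq_iff)
qed

text \<open>The alternating sum is twice the sum over even integers minus the full sum, and the even
sum is again a Gaussian sum, with parameter \<open>4 t\<close> at the point \<open>x / 2\<close>. In the difference of
the two dual series the even frequencies cancel, which leaves the odd multiples of one half.\<close>

theorem gauss_sum_alternating_poisson:
  assumes t: "t > 0"
  shows "(\<lambda>n. (-1) ^ n * (gauss t (x + real n) - gauss t (x - real n - 1))) sums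
     (2 / sqrt t * (\<Sum>m. exp (- pi * (real (2 * m + 1))\<^sup>2 / (4 * t)) * cos (pi * real (2 * m + 1) * x)))"
    (is "_ sums ?R")
proof -
  have t4: "4 * t > 0" using t by simp
  \<comment> \<open>the even integers in the bilateral sum form a Gaussian sum with parameter \<open>4 t\<close>; a negative
    integer \<open>- n - 1\<close> is even when \<open>n\<close> is odd\<close>
  have g4: "gauss (4 * t) (x / 2 + real n) = gauss t (x + real (2 * n))"
      "gauss (4 * t) (x / 2 - real n - 1) = gauss t (x - real (2 * n + 1) - 1)" for n
    by (simp_all add: gauss_def power2_eq_square algebra_simps)
  define a where "a = suminf (\<lambda>n. gauss t (x + real n))"
  define b where "b = suminf (\<lambda>n. gauss t (x - real n - 1))"
  define a2 where "a2 = suminf (\<lambda>n. gauss t (x + real (2 * n)))"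
  define b2 where "b2 = suminf (\<lambda>n. gauss t (x - real (2 * n + 1) - 1))"
  have a: "(\<lambda>n. gauss t (x + real n)) sums a" unfolding a_def by (intro summable_sums summable_gauss t)
  have b: "(\<lambda>n. gauss t (x - real n - 1)) sums b" unfolding b_def by (intro summable_sums summable_gauss' t)
  have a2: "(\<lambda>n. gauss t (x + real (2 * n))) sums a2" unfolding a2_def g4(1)[symmetric] by (intro summable_sums summable_gauss t4)
  have b2: "(\<lambda>n. gauss t (x - real (2 * n + 1) - 1)) sums b2" unfolding b2_def g4(2)[symmetric] by (intro summable_sums summable_gauss' t4)
  have ab: "gauss_sum t x = a + b" 
    using sums_unique2[OF gauss_sums[OF t] sums_add[OF a b]] .
  have ab2: "gauss_sum (4 * t) (x / 2) = a2 + b2" 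
    using sums_unique2[OF gauss_sums[OF t4, of "x / 2"]] sums_add[OF a2 b2] unfolding g4 by blast
  have odd: "(\<lambda>n. (-1) ^ n * gauss t (x - real n - 1)) sums (b - 2 * b2)"
  proof -
    have "(\<lambda>n. if odd n then gauss t (x - real n - 1) else 0) sums b2" using b2 by (simp only: sums_odd_iff)
    from sums_diff[OF b sums_mult[OF this, of 2]]
    show ?thesis by (rule subst[where P = "\<lambda>f. f sums _", rotated]) (auto simp: fun_eq_iff)
  qed
  have L: "(\<lambda>n. (-1) ^ n * (gauss t (x + real n) - gauss t (x - real n - 1))) sums (2 * gauss_sum (4 * t) (x / 2) - gauss_sum t x)"
    unfolding ab ab2 using sums_diff[OF sums_alternating[OF a a2] odd] by (simp add: algebra_simps)
  \<comment> \<open>on the dual side the even frequencies cancel\<close>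
  let ?c = "\<lambda>m. exp (- pi * (real (Suc m))\<^sup>2 / (4 * t)) * cos (2 * pi * real (Suc m) * (x / 2))"
  let ?d = "\<lambda>m. exp (- pi * (real (Suc m))\<^sup>2 / t) * cos (2 * pi * real (Suc m) * x)"
  have c: "?c sums suminf ?c" by (intro summable_sums summable_gauss_coeff_cos t4)
  have d: "?d sums suminf ?d" by (intro summable_sums summable_gauss_coeff_cos t)
  have "?d m = ?c (2 * m + 1)" for m
  proof -
    have "real (Suc (2 * m + 1)) = 2 * real (Suc m)" by simp
    moreover have "- pi * (2 * y)\<^sup>2 / (4 * t) = - pi * y\<^sup>2 / t" for y by (simp add: power_mult_distrib)
    moreover have "2 * pi * (2 * y) * (x / 2) = 2 * pi * y * x" for y by simp
    ultimately show ?thesis by presburger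
  qed
  then have "(\<lambda>m. if odd m then ?c m else 0) sums suminf ?d"
    using d unfolding sums_odd_iff by simp
  from sums_diff[OF c this] have e: "(\<lambda>m. if even m then ?c m else 0) sums (suminf ?c - suminf ?d)" 
    by (rule subst[where P = "\<lambda>f. f sums _", rotated]) (auto simp: fun_eq_iff)
  have "(\<lambda>m. ?c (2 * m)) sums (suminf ?c - suminf ?d)" using e unfolding sums_even_iff .
  moreover have "?c (2 * m) = exp (- pi * (real (2 * m + 1))\<^sup>2 / (4 * t)) * cos (pi * real (2 * m + 1) * x)" for m by (simp add: mult.assoc)
  ultimately have "(\<Sum>m. exp (- pi * (real (2 * m + 1))\<^sup>2 / (4 * t)) * cos (pi * real (2 * m + 1) * x)) = suminf ?c - suminf ?d"
    by (simp add: sums_iff)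
  moreover have "2 * gauss_sum (4 * t) (x / 2) - gauss_sum t x = 2 / sqrt t * (suminf ?c - suminf ?d)"
    unfolding gauss_sum_poisson[OF t] gauss_sum_poisson[OF t4] using t by (simp add: real_sqrt_mult field_simps)
  ultimately show ?thesis using L by simp
qed

section \<open>Dominant terms of the dual sums\<close>

lemma suminf_geometric_bound:
  fixes f :: "nat \<Rightarrow> real"
  assumes "0 < r" "r \<le> 1 / 2" "\<And>m. \<bar>f m\<bar> \<le> r ^ Suc m"
  shows "\<bar>suminf f\<bar> \<le> 2 * r"
proof -
  have sm: "(\<lambda>m. r ^ Suc m) sums (r * (1 / (1 - r)))"
    using sums_mult[OF geometric_sums[of r], of r] assms by simp
  have sn: "summable (\<lambda>m. norm (f m))"
    by (rule summable_comparison_test'[OF sums_summable[OF sm], of 0]) (use assms(3) in auto)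
  have "\<bar>suminf f\<bar> \<le> (\<Sum>m. norm (f m))" using summable_norm[OF sn] by simp
  also have "\<dots> \<le> (\<Sum>m. r ^ Suc m)" using assms(3) by (intro suminf_le sn sums_summable[OF sm]) auto
  also have "\<dots> = r / (1 - r)" using sums_unique[OF sm] by simp
  also have "\<dots> \<le> r / (1 / 2)" using assms by (intro divide_left_mono) auto
  finally show ?thesis by simp
qed

lemma gauss_sum_asymp:
  assumes t: "t > 0" and r: "exp (- pi / t) \<le> 1 / 2"
  shows "\<bar>sqrt t * gauss_sum t x - 1\<bar> \<le> 4 * exp (- pi / t)"
proof -
  have "\<bar>\<Sum>m. exp (- pi * (real (Suc m))\<^sup>2 / t) * cos (2 * pi * real (Suc m) * x)\<bar> \<le> 2 * exp (- pi / t)"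
    by (rule suminf_geometric_bound[OF _ r gauss_coeff_cos_le[OF t]]) simp
  then show ?thesis unfolding gauss_sum_poisson[OF t] using t by simp
qed

text \<open>Divided by \<open>exp (- \<pi> / (4 t))\<close>, the term of index \<open>m\<close> has size
\<open>exp (- \<pi> (m\<^sup>2 + m) / t)\<close>, and \<open>m\<^sup>2 + m \<ge> 2 m\<close>; so the tail after \<open>m = 0\<close> is
dominated by a geometric series of ratio \<open>exp (- 2 \<pi> / t)\<close>.\<close>

lemma gauss_sum_alternating_asymp:
  assumes t: "t > 0" and r: "exp (- pi / t) \<le> 1 / 2"
  shows "\<bar>sqrt t * (\<Sum>n. (-1) ^ n * (gauss t (x + real n) - gauss t (x - real n - 1))) / (2 * exp (- pi / (4 * t))) - cos (pi * x)\<bar>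
     \<le> 2 * exp (- 2 * pi / t)"
proof -
  let ?f = "\<lambda>m. exp (- pi * (real (2 * m + 1))\<^sup>2 / (4 * t)) * cos (pi * real (2 * m + 1) * x)"
  define E where "E = exp (- pi / (4 * t))"
  define g where "g = (\<lambda>m. ?f m / E)"
  have E: "E > 0" by (simp add: E_def)
  have bound: "\<bar>g m\<bar> \<le> exp (- 2 * pi / t) ^ m" for m
  proof -
    have "2 * real m \<le> (real m)\<^sup>2 + real m"
      by (cases m) (auto simp: power2_eq_square algebra_simps)
    then have "pi / t * (2 * real m) \<le> pi / t * ((real m)\<^sup>2 + real m)" using t by (intro mult_left_mono) auto
    moreover have "- pi * (real (2 * m + 1))\<^sup>2 / (4 * t) - - pi / (4 * t) = - (pi / t * ((real m)\<^sup>2 + real m))"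
      using t by (simp add: field_simps power2_eq_square)
    ultimately have "exp (- pi * (real (2 * m + 1))\<^sup>2 / (4 * t)) / E \<le> exp (- (pi / t * (2 * real m)))"
      unfolding E_def exp_diff[symmetric] by simp
    also have "\<dots> = exp (- 2 * pi / t) ^ m" by (simp add: exp_of_nat_mult[symmetric] algebra_simps)
    finally have e: "exp (- pi * (real (2 * m + 1))\<^sup>2 / (4 * t)) / E \<le> exp (- 2 * pi / t) ^ m" .
    have "\<bar>g m\<bar> = exp (- pi * (real (2 * m + 1))\<^sup>2 / (4 * t)) / E * \<bar>cos (pi * real (2 * m + 1) * x)\<bar>"
      using E by (simp add: g_def abs_mult)
    also have "\<dots> \<le> exp (- pi * (real (2 * m + 1))\<^sup>2 / (4 * t)) / E * 1"
      using E by (intro mult_left_mono) auto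
    finally show ?thesis using e by linarith
  qed
  have r2: "exp (- 2 * pi / t) \<le> 1 / 2"
  proof -
    have "exp (- 2 * pi / t) \<le> exp (- pi / t)" using t by (simp add: divide_right_mono)
    then show ?thesis using r by linarith
  qed
  have sg: "summable g"
    by (rule summable_comparison_test'[OF summable_geometric[of "exp (- 2 * pi / t)"], of 0]) (use r2 bound t in auto)
  have g0: "g 0 = cos (pi * x)" by (simp add: g_def E_def)
  have "\<bar>\<Sum>m. g (Suc m)\<bar> \<le> 2 * exp (- 2 * pi / t)"
    by (rule suminf_geometric_bound[OF _ r2 bound]) simp
  moreover have "(\<Sum>m. g (Suc m)) = suminf g - cos (pi * x)"
    using suminf_split_head[OF sg] g0 by simp
  moreover have "suminf g = suminf ?f / E"
  proof -
    have "?f = (\<lambda>m. E * g m)" using E by (simp add: g_def)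
    then have "suminf ?f = E * suminf g" using suminf_mult[OF sg, of E] by simp
    then show ?thesis using E by simp
  qed
  moreover have "sqrt t * (\<Sum>n. (-1) ^ n * (gauss t (x + real n) - gauss t (x - real n - 1))) / (2 * E) = suminf ?f / E"
    using gauss_sum_alternating_poisson[OF t, of x] t E by (simp add: sums_iff)
  ultimately show ?thesis by (simp add: E_def)
qed

section \<open>Infinite q-shifted factorials\<close>

definition qpoch_real :: "real \<Rightarrow> real \<Rightarrow> real" where
  "qpoch_real x q = (\<Prod>k. 1 - x * q ^ k)"

lemma convergent_prod_qpoch:
  fixes q x :: real
  assumes q: "0 < q" "q < 1"
  shows "convergent_prod (\<lambda>k. 1 - x * q ^ k)"
proof -
  have "summable (\<lambda>k. norm (- x * q ^ k))"
    using q by (simp add: abs_mult power_abs) 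
  then have "abs_convergent_prod (\<lambda>k. 1 + (- x * q ^ k))"
    by (simp add: abs_convergent_prod_conv_summable)
  then show ?thesis using abs_convergent_prod_imp_convergent_prod by fastforce
qed

lemma qpoch_inf_of_real:
  assumes q: "0 < q" "q < 1"
  shows "qpoch_inf (of_real x) q = of_real (qpoch_real x q)"
proof -
  have "(\<lambda>k. 1 - x * q ^ k) has_prod qpoch_real x q"
    unfolding qpoch_real_def using convergent_prod_qpoch[OF q] by (rule convergent_prod_has_prod)
  then have "(\<lambda>k. complex_of_real (1 - x * q ^ k)) has_prod of_real (qpoch_real x q)"
    by (simp only: has_prod_of_real_iff)
  from has_prod_unique[OF this] show ?thesis by (simp add: qpoch_inf_def)
qed

text \<open>From \<open>1 / (1 - y) = 1 + y / (1 - y) \<le> exp (y / (1 - y))\<close>.\<close>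

lemma one_minus_ge_exp:
  fixes x y :: real
  assumes "0 \<le> y" "y \<le> x" "x < 1"
  shows "exp (- (y / (1 - x))) \<le> 1 - y"
proof -
  have "1 / (1 - y) = 1 + y / (1 - y)" using assms by (simp add: field_simps)
  also have "\<dots> \<le> exp (y / (1 - y))" by (rule exp_ge_add_one_self)
  also have "\<dots> \<le> exp (y / (1 - x))" using assms by (auto intro!: divide_left_mono)
  finally show ?thesis using assms by (simp add: exp_minus field_simps)
qed

text \<open>Multiplying the bounds \<open>1 - x q\<^sup>k \<ge> exp (- x q\<^sup>k / (1 - x))\<close> and summing the
geometric series in the exponent. As \<open>q\<close> tends to 1 this is cruder than the true size, but it
only costs a power of \<open>1 / (1 - q)\<close> in the exponent.\<close>

lemma qpoch_real_bounds:
  assumes q: "0 < q" "q < 1" and x: "0 \<le> x" "x < 1"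
  shows "exp (- (x / ((1 - x) * (1 - q)))) \<le> qpoch_real x q" and "qpoch_real x q \<le> 1"
proof -
  have lim: "(\<lambda>n. \<Prod>k\<le>n. 1 - x * q ^ k) \<longlonglongrightarrow> qpoch_real x q"
    unfolding qpoch_real_def by (rule convergent_prod_LIMSEQ[OF convergent_prod_qpoch[OF q]])
  have le: "x * q ^ k \<le> x" for k
    using q x mult_left_mono[OF power_le_one[of q k], of x] by simp
  have "(\<Prod>k\<le>n. 1 - x * q ^ k) \<le> 1" for n
    using q x le by (intro prod_le_1) (simp add: le_diff_eq, smt (verit))
  then show "qpoch_real x q \<le> 1" by (intro LIMSEQ_le_const2[OF lim]) auto
  have "exp (- (x / ((1 - x) * (1 - q)))) \<le> (\<Prod>k\<le>n. 1 - x * q ^ k)" for n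
  proof -
    have "(\<Sum>k\<le>n. q ^ k) \<le> 1 / (1 - q)"
      using sum_le_suminf[of "\<lambda>k. q ^ k" "{..n}"] q suminf_geometric[of q] by simp
    then have "x / (1 - x) * (\<Sum>k\<le>n. q ^ k) \<le> x / (1 - x) * (1 / (1 - q))"
      using x by (intro mult_left_mono) auto
    then have "exp (- (x / ((1 - x) * (1 - q)))) \<le> exp (\<Sum>k\<le>n. - (x * q ^ k / (1 - x)))"
      by (simp add: sum_negf sum_distrib_left)
    also have "\<dots> = (\<Prod>k\<le>n. exp (- (x * q ^ k / (1 - x))))" by (rule exp_sum) simp
    also have "\<dots> \<le> (\<Prod>k\<le>n. 1 - x * q ^ k)"
      using le q x by (intro prod_mono conjI one_minus_ge_exp) auto
    finally show ?thesis .
  qed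
  then show "exp (- (x / ((1 - x) * (1 - q)))) \<le> qpoch_real x q" by (intro LIMSEQ_le_const[OF lim]) auto
qed

lemma qpochs_inf_of_real:
  assumes q: "0 < q" "q < 1"
  shows "qpochs_inf (map of_real xs) q = of_real (\<Prod>x\<leftarrow>xs. qpoch_real x q)"
  by (induction xs) (simp_all add: qpochs_inf_def qpoch_inf_of_real[OF q])

lemma prod_list_exp_bounds:
  fixes f :: "'a \<Rightarrow> real"
  assumes "\<And>x. x \<in> set xs \<Longrightarrow> exp (- h) \<le> f x \<and> f x \<le> 1"
  shows "exp (- (real (length xs) * h)) \<le> prod_list (map f xs) \<and> prod_list (map f xs) \<le> 1"
  using assms
proof (induction xs)
  case (Cons x xs)
  then have "exp (- (real (length xs) * h)) \<le> prod_list (map f xs)" "prod_list (map f xs) \<le> 1"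
    "exp (- h) \<le> f x" "f x \<le> 1" by auto
  moreover have pos: "0 \<le> prod_list (map f xs)" "0 \<le> f x"
    using order_trans[OF exp_ge_zero calculation(1)] order_trans[OF exp_ge_zero calculation(3)] .
  ultimately have "exp (- h) * exp (- (real (length xs) * h)) \<le> f x * prod_list (map f xs)"
      "f x * prod_list (map f xs) \<le> 1"
    by (auto intro: mult_mono mult_le_one)
  then show ?case by (simp add: exp_add[symmetric] algebra_simps)
qed simp

definition qcoeff :: "real list \<Rightarrow> real list \<Rightarrow> real \<Rightarrow> nat \<Rightarrow> real" where
  "qcoeff as bs q k = (\<Prod>x\<leftarrow>q ^ (k + 1) # map (\<lambda>b. b * q ^ k) bs. qpoch_real x q) /
     (\<Prod>x\<leftarrow>map (\<lambda>a. a * q ^ k) as. qpoch_real x q)"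

lemma qseries_g_of_real:
  assumes q: "0 < q" "q < 1"
    and summable: "summable (\<lambda>k. qcoeff as bs q k * q powr (l * (real k)\<^sup>2) * (- w) ^ k)"
  shows "qseries_g as bs q l (of_real w) = of_real (\<Sum>k. qcoeff as bs q k * q powr (l * (real k)\<^sup>2) * (- w) ^ k)"
proof -
  have "qpochs_inf (of_real (q ^ (k + 1)) # map (\<lambda>b. of_real (b * q ^ k)) bs) q
           * of_real (q powr (l * (real k)\<^sup>2)) * (- of_real w) ^ k
           / qpochs_inf (map (\<lambda>a. of_real (a * q ^ k)) as) q =
        complex_of_real (qcoeff as bs q k * q powr (l * (real k)\<^sup>2) * (- w) ^ k)" for k
    using qpochs_inf_of_real[OF q, of "q ^ (k + 1) # map (\<lambda>b. b * q ^ k) bs"]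
      qpochs_inf_of_real[OF q, of "map (\<lambda>a. a * q ^ k) as"]
    by (simp add: qcoeff_def o_def)
  then show ?thesis unfolding qseries_g_def by (simp add: suminf_of_real[OF summable])
qed

text \<open>Every factor of the quotient has the form \<open>qpoch_real (q powr \<gamma> * q ^ k) q\<close> with \<open>\<gamma> \<ge> g\<close>, so it lies between
\<open>exp (- h)\<close> and 1 with \<open>h = q\<^sup>k / ((1 - q\<^sup>g) (1 - q))\<close>. The quotient then lies between
\<open>exp (- H q\<^sup>k)\<close> and \<open>exp (H q\<^sup>k)\<close>, where \<open>H q\<^sup>k\<close> is \<open>h\<close> times the number of factors.\<close>

lemma qcoeff_near_one:
  fixes q g :: real
  assumes q: "0 < q" "q < 1" and g: "0 < g" "g \<le> 1"
    and \<alpha>: "\<And>a. a \<in> set \<alpha> \<Longrightarrow> g \<le> a" and \<beta>: "\<And>b. b \<in> set \<beta> \<Longrightarrow> g \<le> b"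
  defines "H \<equiv> real (1 + length \<alpha> + length \<beta>) / ((1 - q powr g) * (1 - q))"
  shows "\<bar>qcoeff (map (\<lambda>a. q powr a) \<alpha>) (map (\<lambda>b. q powr b) \<beta>) q k - 1\<bar> \<le> exp (H * q ^ k) - 1"
proof -
  define h where "h = q ^ k / ((1 - q powr g) * (1 - q))"
  have qg: "0 < q powr g" "q powr g < 1" using q g powr_less_mono'[of q 0 g] by auto
  have qk: "0 < q ^ k" "q ^ k \<le> 1" using q by (auto intro: power_le_one)
  have h0: "h \<ge> 0" using q qg by (simp add: h_def)
  have base: "exp (- h) \<le> qpoch_real (q powr a * q ^ k) q \<and> qpoch_real (q powr a * q ^ k) q \<le> 1" if "g \<le> a" for a
  proof -
    let ?x = "q powr a * q ^ k"
    have qa: "0 < q powr a" "q powr a \<le> q powr g" using q that by (auto simp: powr_le_cancel_iff intro: powr_mono')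
    have x: "0 \<le> ?x" "?x \<le> q ^ k" "?x \<le> q powr g" "?x < 1"
      using mult_mono[of "q powr a" "q powr g" "q ^ k" 1] mult_mono[of "q powr a" 1 "q ^ k" "q ^ k"] qa qg qk by auto
    have "?x / ((1 - ?x) * (1 - q)) \<le> h"
      unfolding h_def using x q qg by (intro frac_le mult_right_mono mult_pos_pos) auto
    then have "exp (- h) \<le> exp (- (?x / ((1 - ?x) * (1 - q))))" by simp
    then show ?thesis using qpoch_real_bounds[OF q x(1,4)] by linarith
  qed
  have num: "exp (- (real (1 + length \<beta>) * h)) \<le> (\<Prod>x\<leftarrow>q ^ (k + 1) # map (\<lambda>b. b * q ^ k) (map (\<lambda>b. q powr b) \<beta>). qpoch_real x q)
     \<and> (\<Prod>x\<leftarrow>q ^ (k + 1) # map (\<lambda>b. b * q ^ k) (map (\<lambda>b. q powr b) \<beta>). qpoch_real x q) \<le> 1" (is "_ \<le> ?N \<and> _")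
    using prod_list_exp_bounds[of "q ^ (k + 1) # map (\<lambda>b. b * q ^ k) (map (\<lambda>b. q powr b) \<beta>)" h "\<lambda>x. qpoch_real x q"]
      base[of 1] base[OF \<beta>] g q by auto
  have den: "exp (- (real (length \<alpha>) * h)) \<le> (\<Prod>x\<leftarrow>map (\<lambda>a. a * q ^ k) (map (\<lambda>a. q powr a) \<alpha>). qpoch_real x q)
     \<and> (\<Prod>x\<leftarrow>map (\<lambda>a. a * q ^ k) (map (\<lambda>a. q powr a) \<alpha>). qpoch_real x q) \<le> 1" (is "_ \<le> ?D \<and> _")
    using prod_list_exp_bounds[of "map (\<lambda>a. a * q ^ k) (map (\<lambda>a. q powr a) \<alpha>)" h "\<lambda>x. qpoch_real x q"]
      base[OF \<alpha>] by auto
  have D0: "?D > 0" using den exp_gt_zero less_le_trans by blast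
  have N0: "?N > 0" using num exp_gt_zero less_le_trans by blast
  have Hh: "H * q ^ k = real (1 + length \<alpha> + length \<beta>) * h" by (simp add: H_def h_def)
  have c: "qcoeff (map (\<lambda>a. q powr a) \<alpha>) (map (\<lambda>b. q powr b) \<beta>) q k = ?N / ?D" by (simp add: qcoeff_def)
  have "?N / ?D \<le> 1 / exp (- (real (length \<alpha>) * h))"
    using num den D0 N0 by (intro frac_le) auto
  also have "\<dots> = exp (real (length \<alpha>) * h)" by (simp add: exp_minus field_simps)
  also have "\<dots> \<le> exp (H * q ^ k)" unfolding Hh using h0 by (simp add: mult_right_mono)
  finally have up: "?N / ?D \<le> exp (H * q ^ k)" .
  have "exp (- (H * q ^ k)) \<le> exp (- (real (1 + length \<beta>) * h))" unfolding Hh using h0 by (simp add: mult_right_mono)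
  also have "\<dots> \<le> ?N / 1" using num by simp
  also have "\<dots> \<le> ?N / ?D" using den D0 N0 by (intro frac_le) auto
  finally have lo: "exp (- (H * q ^ k)) \<le> ?N / ?D" .
  have "exp u + exp (- u) \<ge> 2" for u :: real
    using exp_ge_add_one_self[of u] exp_ge_add_one_self[of "- u"] by linarith
  from this[of "H * q ^ k"] show ?thesis using up lo unfolding c by linarith
qed

lemma inverse_one_minus_exp_le:
  fixes u :: real
  assumes "u > 0" shows "1 / (1 - exp (- u)) \<le> 1 + 1 / u"
proof -
  have "exp (- u) \<le> 1 / (1 + u)"
    using exp_ge_add_one_self[of u] assms by (simp add: exp_minus divide_inverse le_imp_inverse_le)
  then have "u / (1 + u) \<le> 1 - exp (- u)" using assms by (simp add: field_simps)
  then have "1 / (1 - exp (- u)) \<le> 1 / (u / (1 + u))" using assms by (intro divide_left_mono) auto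
  then show ?thesis using assms by (simp add: field_simps)
qed

section \<open>The series as a weighted sum of Gaussians\<close>

text \<open>Completing the square in the exponent; \<open>s = 1\<close> and \<open>s = -1\<close> are the two signs of the
argument in the asymptotic formulas.\<close>

lemma qseries_g_gauss:
  fixes L l v s :: real and n :: nat
  assumes L: "L > 0" and l: "l > 0"
  defines "q \<equiv> exp (- pi / L)" and "t \<equiv> l / L" and "X \<equiv> 2 * real n + v / (l / L)"
  assumes sm: "summable (\<lambda>k. s ^ k * qcoeff as bs q k * gauss t (real k - X))"
  shows "qseries_g as bs q l (of_real (- (s * (q powr (- 4 * real n * l) * exp (2 * pi * v))))) =
    of_real (exp (pi * L / l * (v + 2 * real n * l / L)\<^sup>2) * (\<Sum>k. s ^ k * qcoeff as bs q k * gauss t (real k - X)))"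
proof -
  let ?W = "q powr (- 4 * real n * l) * exp (2 * pi * v)"
  let ?A = "exp (pi * L / l * (v + 2 * real n * l / L)\<^sup>2)"
  have q: "0 < q" "q < 1" using L by (auto simp: q_def)
  have qp: "q powr y = exp (- pi / L * y)" for y by (simp add: q_def powr_def mult.commute)
  have W: "q powr (l * (real k)\<^sup>2) * ?W ^ k = ?A * gauss t (real k - X)" for k
  proof -
    have "?W ^ k = exp (real k * (- pi / L * (- 4 * real n * l) + 2 * pi * v))"
      by (simp only: qp exp_add[symmetric] exp_of_nat_mult[symmetric])
    moreover have "- pi / L * (l * (real k)\<^sup>2) + real k * (- pi / L * (- 4 * real n * l) + 2 * pi * v) =
       pi * L / l * (v + 2 * real n * l / L)\<^sup>2 + - pi * (l / L) * (real k - (2 * real n + v / (l / L)))\<^sup>2"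
      using L l by (simp add: field_simps power2_eq_square)
    ultimately show ?thesis
      by (simp only: qp gauss_def exp_add[symmetric] t_def X_def)
  qed
  have trm: "qcoeff as bs q k * q powr (l * (real k)\<^sup>2) * (- (- (s * ?W))) ^ k =
      ?A * (s ^ k * qcoeff as bs q k * gauss t (real k - X))" for k
  proof -
    have "qcoeff as bs q k * q powr (l * (real k)\<^sup>2) * (- (- (s * ?W))) ^ k = s ^ k * qcoeff as bs q k * (q powr (l * (real k)\<^sup>2) * ?W ^ k)"
      by (simp only: minus_minus power_mult_distrib mult_ac)
    then show ?thesis unfolding W by (simp only: mult_ac)
  qed
  show ?thesis
    using qseries_g_of_real[OF q, of as bs l "- (s * ?W)"] summable_mult[OF sm, of ?A] suminf_mult[OF sm, of ?A]
    unfolding trm by simp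
qed

text \<open>For \<open>q = exp (- \<pi> / L)\<close> both \<open>1 / (1 - q)\<close> and \<open>1 / (1 - q\<^sup>g)\<close> are \<open>O(L)\<close> for \<open>L \<ge> 1\<close>, where \<open>g\<close> is the
smallest exponent that occurs; this gives the factor \<open>L\<^sup>2\<close>. The first bound, valid for every
positive \<open>L\<close>, serves the summability of the series at each fixed index.\<close>

lemma qcoeff_scale_bound:
  fixes \<alpha> \<beta> :: "real list"
  assumes "\<forall>a\<in>set \<alpha>. a > 0" "\<forall>b\<in>set \<beta>. b > 0"
  obtains C where "C \<ge> 0"
    "\<And>L. L > 0 \<Longrightarrow> \<exists>K. \<forall>k. \<bar>qcoeff (map (\<lambda>a. exp (- pi / L) powr a) \<alpha>) (map (\<lambda>b. exp (- pi / L) powr b) \<beta>) (exp (- pi / L)) k - 1\<bar> \<le> K"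
    "\<And>L k. L \<ge> 1 \<Longrightarrow> \<bar>qcoeff (map (\<lambda>a. exp (- pi / L) powr a) \<alpha>) (map (\<lambda>b. exp (- pi / L) powr b) \<beta>) (exp (- pi / L)) k - 1\<bar>
       \<le> exp (C * L\<^sup>2 * exp (- pi * real k / L)) - 1"
proof -
  define g where "g = Min (set (1 # \<alpha> @ \<beta>))"
  have g: "0 < g" "g \<le> 1" "\<And>a. a \<in> set \<alpha> \<Longrightarrow> g \<le> a" "\<And>b. b \<in> set \<beta> \<Longrightarrow> g \<le> b"
    using assms by (auto simp: g_def)
  define p where "p = real (1 + length \<alpha> + length \<beta>)"
  define C where "C = p * ((1 + 1 / (pi * g)) * (1 + 1 / pi))"
  let ?q = "\<lambda>L. exp (- pi / L)"
  let ?c = "\<lambda>L k. qcoeff (map (\<lambda>a. ?q L powr a) \<alpha>) (map (\<lambda>b. ?q L powr b) \<beta>) (?q L) k"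
  let ?H = "\<lambda>L. p / ((1 - ?q L powr g) * (1 - ?q L))"
  have near: "\<bar>?c L k - 1\<bar> \<le> exp (?H L * ?q L ^ k) - 1" if "L > 0" for L k
    unfolding p_def by (rule qcoeff_near_one) (use that g in auto)
  have H0: "?H L \<ge> 0" if "L > 0" for L
  proof -
    have "?q L powr g < 1" using that g by (simp add: powr_def)
    then show ?thesis using that by (simp add: p_def)
  qed
  have p0: "p \<ge> 0" by (simp add: p_def)
  show ?thesis
  proof (rule that)
    show "C \<ge> 0" using g p0 by (simp add: C_def)
    show "\<exists>K. \<forall>k. \<bar>?c L k - 1\<bar> \<le> K" if "L > 0" for L
    proof (intro exI allI)
      fix k
      have "?q L ^ k \<le> 1" using that by (intro power_le_one) auto
      then have "?H L * ?q L ^ k \<le> ?H L * 1" by (intro mult_left_mono H0 that)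
      then show "\<bar>?c L k - 1\<bar> \<le> exp (?H L * 1) - 1" using near[OF that, of k] exp_le_cancel_iff by (smt (verit))
    qed
    show "\<bar>?c L k - 1\<bar> \<le> exp (C * L\<^sup>2 * exp (- pi * real k / L)) - 1" if L: "L \<ge> 1" for L k
    proof -
      have qk: "?q L ^ k = exp (- pi * real k / L)" by (simp add: exp_of_nat_mult[symmetric] mult.commute)
      have qg: "?q L powr g = exp (- (pi * g / L))" by (simp add: powr_def mult.commute)
      have inv: "1 / (1 - exp (- (u / L))) \<le> L * (1 + 1 / u)" if "u > 0" for u
      proof -
        have "1 / (1 - exp (- (u / L))) \<le> 1 + L / u"
          using inverse_one_minus_exp_le[of "u / L"] that L by simp
        then show ?thesis using L by (simp add: distrib_left)
      qed
      have 1: "1 / (1 - ?q L powr g) \<le> L * (1 + 1 / (pi * g))"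
        unfolding qg by (rule inv) (use g in simp)
      have 2: "1 / (1 - ?q L) \<le> L * (1 + 1 / pi)"
        using inv[of pi] by simp
      have "?H L = p * (1 / (1 - ?q L powr g) * (1 / (1 - ?q L)))" by simp
      also have "\<dots> \<le> p * ((L * (1 + 1 / (pi * g))) * (L * (1 + 1 / pi)))"
        using 1 2 p0 L g by (intro mult_left_mono mult_mono) auto
      also have "\<dots> = C * L\<^sup>2" by (simp add: C_def power2_eq_square mult_ac)
      finally have "?H L * ?q L ^ k \<le> C * L\<^sup>2 * ?q L ^ k" by (rule mult_right_mono) simp
      then have "exp (?H L * ?q L ^ k) \<le> exp (C * L\<^sup>2 * ?q L ^ k)" by simp
      then show ?thesis using near[of L k] L unfolding qk by linarith
    qed
  qed
qed

section \<open>Replacing the weights by one\<close>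

text \<open>Three errors are collected: the terms \<open>k < n\<close>, where the weight may be large but the Gaussian
is at most \<open>\<eta>\<close>; the terms \<open>k \<ge> n\<close>, where the weight is within \<open>\<epsilon>\<close> of 1; and the negative
integers, where \<open>gauss t (X + k + 1) \<le> gauss t X * gauss t k\<close>.\<close>

lemma suminf_truncation_error:
  fixes c :: "nat \<Rightarrow> real" and s :: real
  assumes t: "t > 0" and s: "\<bar>s\<bar> = 1" and X: "X \<ge> 0"
    and K: "\<And>k. \<bar>c k - 1\<bar> \<le> K" and \<epsilon>: "\<And>k. k \<ge> n \<Longrightarrow> \<bar>c k - 1\<bar> \<le> \<epsilon>"
    and \<eta>: "\<And>k. k < n \<Longrightarrow> gauss t (real k - X) \<le> \<eta>"
  shows "\<bar>(\<Sum>k. s ^ k * c k * gauss t (real k - X))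
          - (\<Sum>k. s ^ k * (gauss t (- X + real k) + s * gauss t (- X - real k - 1)))\<bar>
        \<le> real n * (K * \<eta>) + \<epsilon> * gauss_sum t (- X) + gauss t X * gauss_sum t 0"
proof -
  have sp: "\<bar>s ^ k\<bar> = 1" for k using s by (simp add: power_abs)
  have K0: "K \<ge> 0" using K[of 0] by linarith
  have \<epsilon>0: "\<epsilon> \<ge> 0" using \<epsilon>[of n] by linarith
  have sg: "summable (\<lambda>k. gauss t (real k - X))" using summable_gauss[OF t, of "- X"] by (simp add: add.commute)
  have sg': "summable (\<lambda>k. gauss t (- X - real k - 1))" by (rule summable_gauss'[OF t])
  have sgs: "summable (\<lambda>k. s ^ k * gauss t (real k - X))"
    by (rule summable_comparison_test'[OF sg, of 0]) (simp add: abs_mult sp gauss_nonneg)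
  have sgs': "summable (\<lambda>k. s ^ k * (s * gauss t (- X - real k - 1)))"
    by (rule summable_comparison_test'[OF sg', of 0]) (simp add: abs_mult sp s gauss_nonneg)
  have "norm (s ^ k * ((c k - 1) * gauss t (real k - X))) \<le> K * gauss t (real k - X)" for k
    using mult_right_mono[OF K gauss_nonneg] by (simp add: abs_mult sp gauss_nonneg)
  then have sd: "summable (\<lambda>k. s ^ k * ((c k - 1) * gauss t (real k - X)))"
    by (intro summable_comparison_test'[OF summable_mult[OF sg, of K], of 0])
  have "(\<lambda>k. s ^ k * c k * gauss t (real k - X)) = (\<lambda>k. s ^ k * ((c k - 1) * gauss t (real k - X)) + s ^ k * gauss t (real k - X))"
    by (auto simp: algebra_simps)
  then have sT: "summable (\<lambda>k. s ^ k * c k * gauss t (real k - X))"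
    using summable_add[OF sd sgs] by simp
  have diff: "(\<Sum>k. s ^ k * c k * gauss t (real k - X)) - (\<Sum>k. s ^ k * (gauss t (- X + real k) + s * gauss t (- X - real k - 1)))
     = (\<Sum>k. s ^ k * ((c k - 1) * gauss t (real k - X)) - s ^ k * (s * gauss t (- X - real k - 1)))"
    using suminf_diff[OF sT summable_add[OF sgs sgs']] by (simp add: algebra_simps)
  have "\<bar>\<Sum>k. s ^ k * ((c k - 1) * gauss t (real k - X)) - s ^ k * (s * gauss t (- X - real k - 1))\<bar> \<le> (\<Sum>k. ((if k < n then K * \<eta> else 0) + \<epsilon> * gauss t (real k - X)) + gauss t X * gauss t (real k))"
  proof -
    let ?b = "\<lambda>k. ((if k < n then K * \<eta> else 0) + \<epsilon> * gauss t (real k - X)) + gauss t X * gauss t (real k)"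
    have sb: "summable ?b"
      using summable_gauss[OF t, of 0] by (intro summable_add summable_mult sg summable_If_finite[of "\<lambda>k. k < n"]) auto
    have le: "norm (s ^ k * ((c k - 1) * gauss t (real k - X)) - s ^ k * (s * gauss t (- X - real k - 1))) \<le> ?b k" for k
    proof -
      have "\<bar>c k - 1\<bar> * gauss t (real k - X) \<le> (if k < n then K * \<eta> else 0) + \<epsilon> * gauss t (real k - X)"
      proof (cases "k < n")
        case True
        have "\<bar>c k - 1\<bar> * gauss t (real k - X) \<le> K * \<eta>"
          using K \<eta>[OF True] K0 by (intro mult_mono) (auto simp: gauss_nonneg)
        then show ?thesis using True \<epsilon>0 by (simp add: gauss_nonneg add_increasing2)
      next
        case False
        then show ?thesis using mult_right_mono[OF \<epsilon>[of k] gauss_nonneg] by auto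
      qed
      moreover have "gauss t (- X - real k - 1) \<le> gauss t X * gauss t (real k)"
      proof -
        have "X\<^sup>2 + (real k)\<^sup>2 \<le> (- X - real k - 1)\<^sup>2"
          using X by (simp add: power2_eq_square algebra_simps)
        then have "pi * t * (X\<^sup>2 + (real k)\<^sup>2) \<le> pi * t * (- X - real k - 1)\<^sup>2"
          using t by (intro mult_left_mono) auto
        then show ?thesis by (simp add: gauss_def exp_add[symmetric] distrib_left)
      qed
      moreover have "norm (s ^ k * ((c k - 1) * gauss t (real k - X)) - s ^ k * (s * gauss t (- X - real k - 1)))
         \<le> \<bar>c k - 1\<bar> * gauss t (real k - X) + gauss t (- X - real k - 1)"
        by (rule order_trans[OF norm_triangle_ineq4]) (simp add: abs_mult sp s gauss_nonneg)
      ultimately show ?thesis by linarith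
    qed
    have sn: "summable (\<lambda>k. norm (s ^ k * ((c k - 1) * gauss t (real k - X)) - s ^ k * (s * gauss t (- X - real k - 1))))"
      by (rule summable_comparison_test'[OF sb, of 0]) (use le in auto)
    show ?thesis using order_trans[OF summable_norm[OF sn] suminf_le[OF le sn sb]] by simp
  qed
  also have "\<dots> = real n * (K * \<eta>) + \<epsilon> * (\<Sum>k. gauss t (real k - X)) + gauss t X * (\<Sum>k. gauss t (real k))"
  proof -
    have fin: "(\<lambda>k. if k < n then K * \<eta> else 0) sums (real n * (K * \<eta>))"
      using sums_If_finite_set[of "{..<n}" "\<lambda>_. K * \<eta>"] by (simp only: lessThan_iff sum_constant card_lessThan finite_lessThan)
    have "(\<lambda>k. gauss t (real k)) sums (\<Sum>k. gauss t (real k))"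
      using summable_sums[OF summable_gauss[OF t, of 0]] by (simp only: add_0)
    from sums_unique[OF sums_add[OF sums_add[OF fin sums_mult[OF summable_sums[OF sg], of \<epsilon>]] sums_mult[OF this, of "gauss t X"]]]
    show ?thesis by (rule sym)
  qed
  finally have le: "\<bar>\<Sum>k. s ^ k * ((c k - 1) * gauss t (real k - X)) - s ^ k * (s * gauss t (- X - real k - 1))\<bar>
        \<le> real n * (K * \<eta>) + \<epsilon> * (\<Sum>k. gauss t (real k - X)) + gauss t X * (\<Sum>k. gauss t (real k))" .
  have "(\<Sum>k. gauss t (real k - X)) \<le> gauss_sum t (- X)"
    unfolding gauss_sum_def
    by (rule suminf_le[OF _ sg sums_summable[OF gauss_sums[OF t]]]) (simp add: gauss_nonneg)
  moreover have "(\<Sum>k. gauss t (real k)) \<le> gauss_sum t 0"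
    unfolding gauss_sum_def 
    by (rule suminf_le[OF _ _ sums_summable[OF gauss_sums[OF t]]]) (use summable_gauss[OF t, of 0] in \<open>simp_all add: gauss_nonneg\<close>)
  ultimately have "\<epsilon> * (\<Sum>k. gauss t (real k - X)) \<le> \<epsilon> * gauss_sum t (- X)"
      "gauss t X * (\<Sum>k. gauss t (real k)) \<le> gauss t X * gauss_sum t 0"
    using \<epsilon>0 by (auto intro!: mult_left_mono simp: gauss_nonneg)
  with le show "\<bar>(\<Sum>k. s ^ k * c k * gauss t (real k - X))
          - (\<Sum>k. s ^ k * (gauss t (- X + real k) + s * gauss t (- X - real k - 1)))\<bar>
        \<le> real n * (K * \<eta>) + \<epsilon> * gauss_sum t (- X) + gauss t X * gauss_sum t 0"
    unfolding diff by linarith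
qed

text \<open>The growth over \<open>ln n\<close> makes the scale unbounded, and the second condition says that
\<open>n\<close> dominates every multiple of its square.\<close>

lemma admissible_scale_eventually:
  assumes "admissible_scale lam" "B \<ge> 0"
  shows "\<forall>\<^sub>F n in sequentially. B \<le> lam n \<and> B * (lam n)\<^sup>2 \<le> real n"
proof -
  have pos: "\<And>n. n \<ge> 1 \<Longrightarrow> lam n > 0"
    and 1: "\<forall>\<^sub>F n in sequentially. B \<le> lam n / ln (real n)"
    and 2: "\<forall>\<^sub>F n in sequentially. B \<le> real n / (lam n)\<^sup>2"
    using assms(1) unfolding admissible_scale_def filterlim_at_top by blast+
  show ?thesis
    using 1 2 eventually_ge_at_top[of 3]
  proof eventually_elim
    case (elim n)
    have ln: "1 \<le> ln (real n)"
      using elim(3) exp_le by (subst ln_ge_iff) auto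
    then have "B * ln (real n) \<le> lam n" using elim(1) by (simp add: pos_le_divide_eq)
    moreover have "B * 1 \<le> B * ln (real n)" using ln assms(2) by (intro mult_left_mono)
    ultimately show ?case using elim pos[of n] by (simp add: pos_le_divide_eq)
  qed
qed

text \<open>The numerical content of admissibility, with \<open>L\<close> the value of the scale. From \<open>n \<ge> B L\<^sup>2\<close>
follow \<open>n / L \<ge> B L\<close> and \<open>n\<^sup>2 / L \<ge> B n\<close>, so for large \<open>B\<close> the exponent \<open>n / L\<close> beats any
fixed multiple of \<open>L\<close>, and \<open>n\<^sup>2 / L\<close> any fixed multiple of \<open>n\<close>, hence of \<open>L\<^sup>2\<close>. The bound on \<open>V L / l\<close> keeps
the peak \<open>2 n + v L / l\<close> at distance at least \<open>n / 2\<close> from all \<open>k < n\<close> when \<open>\<bar>v\<bar> \<le> V\<close>.\<close>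

lemma scale_estimates:
  fixes C M V l :: real
  assumes "C \<ge> 0" "M \<ge> 0" "V \<ge> 0" "l > 0"
  obtains B where "B \<ge> 0" "\<And>L n. B \<le> L \<Longrightarrow> B * L\<^sup>2 \<le> n \<Longrightarrow> 
      1 \<le> L \<and> l \<le> L \<and> V * L / l \<le> n / 2 \<and>
      n * (exp (C * L\<^sup>2) * exp (- pi * (l / L) * (n / 2)\<^sup>2)) \<le> exp (- M * L) \<and>
      exp (C * L\<^sup>2 * exp (- pi * n / L)) - 1 \<le> exp (- M * L) \<and>
      exp (- pi * (l / L) * n\<^sup>2) \<le> exp (- M * L)"
proof
  \<comment> \<open>each summand is a lower bound for \<open>B\<close> demanded by one of the claims below\<close>
  define B where "B = 3 + C + M + l + 2 * V / l + 4 * (1 + C + M) / (pi * l)"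
  have nn: "0 \<le> 2 * V / l" "0 \<le> 4 * (1 + C + M) / (pi * l)" using assms by simp_all
  have B: "B \<ge> 1" "B \<ge> 3 + C + M" "B \<ge> l" "B \<ge> 2 * V / l" "B \<ge> 4 * (1 + C + M) / (pi * l)"
    using nn assms by (simp_all add: B_def)
  show "B \<ge> 0" using B by simp
  fix L n assume L: "B \<le> L" and n: "B * L\<^sup>2 \<le> n"
  have L1: "1 \<le> L" using B L by simp
  have LL: "L \<le> L\<^sup>2" using L1 by (simp add: power2_eq_square)
  have "1 * L\<^sup>2 \<le> B * L\<^sup>2" using B(1) by (intro mult_right_mono) auto
  then have nL: "L\<^sup>2 \<le> n" "L \<le> n" "1 \<le> n" using n LL L1 by linarith+
  have nd: "B * L \<le> n / L" using n L1 by (simp add: pos_le_divide_eq power2_eq_square mult.assoc)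
  have BL: "B \<le> B * L" using B(1) L1 by simp
  have v: "V * L / l \<le> n / 2"
  proof -
    have "2 * V / l * L \<le> B * L" using B(4) L1 by (intro mult_right_mono) auto
    also have "\<dots> \<le> B * L\<^sup>2" using LL B(1) by (intro mult_left_mono) auto
    finally show ?thesis using n by (simp add: mult_ac)
  qed
  have q: "(1 + C + M) * n \<le> pi * (l / L) * (n / 2)\<^sup>2"
  proof -
    have "4 * (1 + C + M) / (pi * l) \<le> n / L" using B(5) BL nd by linarith
    then have "4 * (1 + C + M) / (pi * l) * (pi * l / 4 * n) \<le> n / L * (pi * l / 4 * n)"
      using assms nL by (intro mult_right_mono) auto
    moreover have "4 * (1 + C + M) / (pi * l) * (pi * l / 4 * n) = (1 + C + M) * n" using assms by simp
    moreover have "n / L * (pi * l / 4 * n) = pi * (l / L) * (n / 2)\<^sup>2" by (simp add: power2_eq_square)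
    ultimately show ?thesis by (simp only:)
  qed
  have MC: "M * L \<le> M * n" "C * L\<^sup>2 \<le> C * n" using assms nL by (auto intro: mult_left_mono)
  have a: "n * (exp (C * L\<^sup>2) * exp (- pi * (l / L) * (n / 2)\<^sup>2)) \<le> exp (- M * L)"
  proof -
    have "n \<le> exp n" using exp_ge_add_one_self[of n] by linarith
    then have "n * (exp (C * L\<^sup>2) * exp (- pi * (l / L) * (n / 2)\<^sup>2)) \<le> exp n * (exp (C * L\<^sup>2) * exp (- pi * (l / L) * (n / 2)\<^sup>2))"
      by (intro mult_right_mono) auto
    also have "\<dots> = exp (n + C * L\<^sup>2 - pi * (l / L) * (n / 2)\<^sup>2)" by (simp add: exp_add[symmetric])
    also have "\<dots> \<le> exp (- M * L)" using q MC by (simp add: algebra_simps)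
    finally show ?thesis .
  qed
  have b: "exp (C * L\<^sup>2 * exp (- pi * n / L)) - 1 \<le> exp (- M * L)"
  proof -
    define Y where "Y = C * L\<^sup>2 * exp (- pi * n / L)"
    have "(3 + C + M) * L \<le> B * L" using B(2) L1 by (intro mult_right_mono) auto
    moreover have "1 * (n / L) \<le> pi * (n / L)" using pi_gt3 nL L1 by (intro mult_right_mono) auto
    ultimately have e: "- pi * n / L \<le> - ((3 + C + M) * L)" using nd by simp
    have "C \<le> exp C" using exp_ge_add_one_self[of C] by linarith
    also have "\<dots> \<le> exp (C * L)" using assms L1 by (simp add: mult_le_cancel_left1)
    finally have c: "C \<le> exp (C * L)" .
    have "L\<^sup>2 \<le> 2 * exp L" using exp_lower_Taylor_quadratic[of L] L1 by simp
    then have "Y \<le> exp (C * L) * (2 * exp L) * exp (- ((3 + C + M) * L))"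
      unfolding Y_def using c e assms by (intro mult_mono) auto
    also have "\<dots> = 2 * (exp (- L) * exp (- L) * exp (- M * L))"
      by (simp add: exp_add[symmetric] algebra_simps)
    finally have Y: "Y \<le> 2 * (exp (- L) * exp (- L) * exp (- M * L))" .
    have "exp L \<ge> 2" using exp_ge_add_one_self[of L] L1 by linarith
    then have h: "exp (- L) \<le> 1 / 2" by (simp add: exp_minus field_simps)
    have "exp (- L) * exp (- L) \<le> 1 / 2 * (1 / 2)" using h by (intro mult_mono) auto
    then have "exp (- L) * exp (- L) * exp (- M * L) \<le> 1 / 4 * exp (- M * L)" by (intro mult_right_mono) auto
    then have Y2: "2 * Y \<le> exp (- M * L)" using Y by linarith
    have "exp (- M * L) \<le> 1" using assms L1 by simp
    then have Y1: "Y \<le> 1" using Y2 by linarith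
    have Y0: "0 \<le> Y" using assms by (simp add: Y_def)
    have "exp Y \<le> 1 + Y + Y\<^sup>2" by (rule exp_bound[OF Y0 Y1])
    moreover have "Y\<^sup>2 \<le> Y" using Y0 Y1 by (simp add: power2_eq_square mult_left_le)
    ultimately show ?thesis using Y2 unfolding Y_def[symmetric] by linarith
  qed
  have c: "exp (- pi * (l / L) * n\<^sup>2) \<le> exp (- M * L)"
  proof -
    have "M * n \<le> (1 + C + M) * n" using assms nL by (intro mult_right_mono) auto
    moreover have "pi * (l / L) * (n / 2)\<^sup>2 \<le> pi * (l / L) * n\<^sup>2"
      using assms L1 nL by (intro mult_left_mono) (auto simp: power2_eq_square)
    ultimately show ?thesis using q MC by simp
  qed
  show "1 \<le> L \<and> l \<le> L \<and> V * L / l \<le> n / 2 \<and>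
      n * (exp (C * L\<^sup>2) * exp (- pi * (l / L) * (n / 2)\<^sup>2)) \<le> exp (- M * L) \<and>
      exp (C * L\<^sup>2 * exp (- pi * n / L)) - 1 \<le> exp (- M * L) \<and>
      exp (- pi * (l / L) * n\<^sup>2) \<le> exp (- M * L)"
    using L1 L B(3) v a b c by auto
qed

definition weighted_gauss_sum :: "real \<Rightarrow> (nat \<Rightarrow> real) \<Rightarrow> real \<Rightarrow> real \<Rightarrow> real" where
  "weighted_gauss_sum s c t X = (\<Sum>k. s ^ k * c k * gauss t (real k - X))"

lemma exp_neg_pi_le_half:
  fixes l L :: real
  assumes l: "l > 0" and L: "l \<le> L"
  shows "exp (- pi / (l / L)) \<le> 1 / 2"
proof -
  have "1 \<le> L / l" using L l by simp
  then have "pi * 1 \<le> pi * (L / l)" by (intro mult_left_mono) auto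
  then have "1 \<le> pi * (L / l)" using pi_gt3 by linarith
  then have "2 \<le> exp (pi * (L / l))" using exp_ge_add_one_self[of "pi * (L / l)"] by linarith
  then show ?thesis by (simp add: exp_minus field_simps)
qed

text \<open>The number \<open>M\<close> is arbitrary: replacing the weights by 1 and extending the sum to all integers
costs less than any fixed exponential in the scale, hence less than the next term of the dual
series.\<close>

lemma weighted_gauss_sum_approx:
  fixes lam :: "nat \<Rightarrow> real" and c :: "nat \<Rightarrow> nat \<Rightarrow> real"
  assumes adm: "admissible_scale lam" and l: "l > 0" and C: "C \<ge> 0" and V: "V \<ge> 0" and M: "M \<ge> 0"
    and c: "\<And>n k. n \<ge> 1 \<Longrightarrow> lam n \<ge> 1 \<Longrightarrow> \<bar>c n k - 1\<bar> \<le> exp (C * (lam n)\<^sup>2 * exp (- pi * real k / lam n)) - 1"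
  shows "\<forall>\<^sub>F n in sequentially. \<forall>v s. \<bar>v\<bar> \<le> V \<longrightarrow> \<bar>s\<bar> = 1 \<longrightarrow>
     sqrt (l / lam n) * \<bar>weighted_gauss_sum s (c n) (l / lam n) (2 * real n + v / (l / lam n))
        - (\<Sum>k. s ^ k * (gauss (l / lam n) (- (2 * real n + v / (l / lam n)) + real k)
                    + s * gauss (l / lam n) (- (2 * real n + v / (l / lam n)) - real k - 1)))\<bar>
      \<le> 7 * exp (- M * lam n)"
proof -
  obtain B where B: "B \<ge> 0" "\<And>L n. B \<le> L \<Longrightarrow> B * L\<^sup>2 \<le> n \<Longrightarrow> 
      1 \<le> L \<and> l \<le> L \<and> V * L / l \<le> n / 2 \<and>
      n * (exp (C * L\<^sup>2) * exp (- pi * (l / L) * (n / 2)\<^sup>2)) \<le> exp (- M * L) \<and>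
      exp (C * L\<^sup>2 * exp (- pi * n / L)) - 1 \<le> exp (- M * L) \<and>
      exp (- pi * (l / L) * n\<^sup>2) \<le> exp (- M * L)"
    using scale_estimates[OF C M V l] by blast
  show "\<forall>\<^sub>F n in sequentially. \<forall>v s. \<bar>v\<bar> \<le> V \<longrightarrow> \<bar>s\<bar> = 1 \<longrightarrow>
     sqrt (l / lam n) * \<bar>weighted_gauss_sum s (c n) (l / lam n) (2 * real n + v / (l / lam n))
        - (\<Sum>k. s ^ k * (gauss (l / lam n) (- (2 * real n + v / (l / lam n)) + real k)
                    + s * gauss (l / lam n) (- (2 * real n + v / (l / lam n)) - real k - 1)))\<bar>
      \<le> 7 * exp (- M * lam n)"
    using admissible_scale_eventually[OF adm B(1)] eventually_ge_at_top[of 1]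
  proof (eventually_elim, intro allI impI)
    fix n :: nat and v s :: real
    assume n: "B \<le> lam n \<and> B * (lam n)\<^sup>2 \<le> real n" and n1: "1 \<le> n" and v: "\<bar>v\<bar> \<le> V" and s: "\<bar>s\<bar> = 1"
    define L where "L = lam n"
    define t where "t = l / L"
    define X where "X = 2 * real n + v / t"
    have est: "1 \<le> L" "l \<le> L" "V * L / l \<le> real n / 2"
      "real n * (exp (C * L\<^sup>2) * exp (- pi * t * (real n / 2)\<^sup>2)) \<le> exp (- M * L)"
      "exp (C * L\<^sup>2 * exp (- pi * real n / L)) - 1 \<le> exp (- M * L)"
      "exp (- pi * t * (real n)\<^sup>2) \<le> exp (- M * L)"
      using B(2)[of L "real n"] n unfolding L_def t_def by blast+
    have t: "t > 0" "t \<le> 1" using est l by (simp_all add: t_def)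
    have "\<bar>v / t\<bar> = \<bar>v\<bar> * L / l" using est l by (simp add: t_def abs_mult)
    also have "\<dots> \<le> V * L / l" using v est l by (intro divide_right_mono mult_right_mono) auto
    finally have vt: "\<bar>v / t\<bar> \<le> real n / 2" using est(3) by linarith
    have X: "X \<ge> real n" unfolding X_def using vt of_nat_0_le_iff[of n] by linarith
    have ck: "\<bar>c n k - 1\<bar> \<le> exp (C * L\<^sup>2 * exp (- pi * real k / L)) - 1" for k
      using c[OF n1, of k] est(1) unfolding L_def .
    have K: "\<bar>c n k - 1\<bar> \<le> exp (C * L\<^sup>2)" for k
    proof -
      have "C * L\<^sup>2 * exp (- pi * real k / L) \<le> C * L\<^sup>2 * 1"
        using C est(1) by (intro mult_left_mono) auto
      then have "exp (C * L\<^sup>2 * exp (- pi * real k / L)) \<le> exp (C * L\<^sup>2)" by simp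
      then show ?thesis using ck[of k] by linarith
    qed
    have eps: "\<bar>c n k - 1\<bar> \<le> exp (- M * L)" if "n \<le> k" for k
    proof -
      have "- pi * real k / L \<le> - pi * real n / L" using that est(1) by (simp add: divide_right_mono)
      then have "C * L\<^sup>2 * exp (- pi * real k / L) \<le> C * L\<^sup>2 * exp (- pi * real n / L)"
        using C by (intro mult_left_mono) auto
      then have "exp (C * L\<^sup>2 * exp (- pi * real k / L)) \<le> exp (C * L\<^sup>2 * exp (- pi * real n / L))" by simp
      then show ?thesis using ck[of k] est(5) by linarith
    qed
    have eta: "gauss t (real k - X) \<le> exp (- pi * t * (real n / 2)\<^sup>2)" if "k < n" for k
    proof -
      have "real k \<le> real n" using that by simp
      then have "real n / 2 \<le> X - real k" using vt unfolding X_def abs_le_iff by linarith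
      then have "(real n / 2)\<^sup>2 \<le> (X - real k)\<^sup>2" by (intro power_mono) auto
      then have "pi * t * (real n / 2)\<^sup>2 \<le> pi * t * (X - real k)\<^sup>2" using t by (intro mult_left_mono) auto
      then show ?thesis by (simp add: gauss_def power2_commute[of "real k" X])
    qed
    have gX: "gauss t X \<le> exp (- M * L)"
    proof -
      have "(real n)\<^sup>2 \<le> X\<^sup>2" using X by (intro power_mono) auto
      then have "pi * t * (real n)\<^sup>2 \<le> pi * t * X\<^sup>2" using t by (intro mult_left_mono) auto
      then have "gauss t X \<le> exp (- pi * t * (real n)\<^sup>2)" by (simp add: gauss_def)
      then show ?thesis using est(6) by linarith
    qed
    have r: "exp (- pi / t) \<le> 1 / 2" unfolding t_def by (rule exp_neg_pi_le_half[OF l est(2)])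
    have gs: "sqrt t * gauss_sum t x \<le> 3" for x
      using gauss_sum_asymp[OF t(1) r, of x] r by linarith
    have X0: "X \<ge> 0" using X by linarith
    let ?e = "exp (- M * L)"
    have "\<bar>weighted_gauss_sum s (c n) t X - (\<Sum>k. s ^ k * (gauss t (- X + real k) + s * gauss t (- X - real k - 1)))\<bar>
      \<le> real n * (exp (C * L\<^sup>2) * exp (- pi * t * (real n / 2)\<^sup>2)) + ?e * gauss_sum t (- X) + gauss t X * gauss_sum t 0"
      unfolding weighted_gauss_sum_def by (rule suminf_truncation_error[OF t(1) s X0 K eps eta])
    then have "sqrt t * \<bar>weighted_gauss_sum s (c n) t X - (\<Sum>k. s ^ k * (gauss t (- X + real k) + s * gauss t (- X - real k - 1)))\<bar>
      \<le> sqrt t * (real n * (exp (C * L\<^sup>2) * exp (- pi * t * (real n / 2)\<^sup>2)) + ?e * gauss_sum t (- X) + gauss t X * gauss_sum t 0)"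
      using t by (intro mult_left_mono) auto
    also have "\<dots> = sqrt t * (real n * (exp (C * L\<^sup>2) * exp (- pi * t * (real n / 2)\<^sup>2))) + ?e * (sqrt t * gauss_sum t (- X)) + gauss t X * (sqrt t * gauss_sum t 0)"
      by (simp add: algebra_simps)
    also have "\<dots> \<le> 1 * ?e + ?e * 3 + ?e * 3"
    proof (intro add_mono)
      show "sqrt t * (real n * (exp (C * L\<^sup>2) * exp (- pi * t * (real n / 2)\<^sup>2))) \<le> 1 * ?e"
        using est(4) t by (intro mult_mono) auto
      show "?e * (sqrt t * gauss_sum t (- X)) \<le> ?e * 3" by (intro mult_left_mono gs) simp
      have "gauss t X * (sqrt t * gauss_sum t 0) \<le> gauss t X * 3" by (intro mult_left_mono gs gauss_nonneg)
      then show "gauss t X * (sqrt t * gauss_sum t 0) \<le> ?e * 3" using gX by linarith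
    qed
    finally show "sqrt (l / lam n) * \<bar>weighted_gauss_sum s (c n) (l / lam n) (2 * real n + v / (l / lam n))
        - (\<Sum>k. s ^ k * (gauss (l / lam n) (- (2 * real n + v / (l / lam n)) + real k)
                    + s * gauss (l / lam n) (- (2 * real n + v / (l / lam n)) - real k - 1)))\<bar>
      \<le> 7 * exp (- M * lam n)"
      unfolding X_def t_def L_def by simp
  qed
qed

section \<open>The asymptotic formulas\<close>

text \<open>Compact sets are bounded, so bounds uniform on the intervals \<open>[- V, V]\<close> suffice.\<close>

lemma bigo_loc_unifI:
  assumes "\<And>V. V \<ge> 0 \<Longrightarrow> \<exists>C. \<forall>\<^sub>F n in sequentially. \<forall>v. \<bar>v\<bar> \<le> V \<longrightarrow> \<bar>f n v\<bar> \<le> C * \<bar>h n v\<bar>"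
  shows "bigo_loc_unif f h"
  unfolding bigo_loc_unif_def
proof (intro allI impI)
  fix K :: "real set" assume "compact K"
  then obtain V where V: "V > 0" "\<And>v. v \<in> K \<Longrightarrow> \<bar>v\<bar> \<le> V"
    using compact_imp_bounded bounded_pos by (metis real_norm_def)
  from assms[of V] V(1) obtain C where C: "\<forall>\<^sub>F n in sequentially. \<forall>v. \<bar>v\<bar> \<le> V \<longrightarrow> \<bar>f n v\<bar> \<le> C * \<bar>h n v\<bar>" by auto
  have "\<forall>\<^sub>F p in sequentially \<times>\<^sub>F principal K. norm (case p of (n, v) \<Rightarrow> f n v) \<le> C * norm (case p of (n, v) \<Rightarrow> h n v)"
    unfolding eventually_prod_filter eventually_principal
    by (rule exI[of _ "\<lambda>n. \<forall>v. \<bar>v\<bar> \<le> V \<longrightarrow> \<bar>f n v\<bar> \<le> C * \<bar>h n v\<bar>"], rule exI[of _ "\<lambda>v. v \<in> K"])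
       (use C V(2) in auto)
  then show "(\<lambda>(n, v). f n v) \<in> O[sequentially \<times>\<^sub>F principal K](\<lambda>(n, v). h n v)"
    by (rule bigoI)
qed

theorem theorem3p2:
  fixes lam q :: "nat \<Rightarrow> real" and z :: "real \<Rightarrow> real"
    and \<alpha> \<beta> :: "real list" and l :: real
    and G :: "nat \<Rightarrow> complex \<Rightarrow> complex"
  assumes "admissible_scale lam"
    and "l > 0"
    and "\<forall>a\<in>set \<alpha>. a > 0"
    and "\<forall>b\<in>set \<beta>. b > 0"
    and "\<And>v. z v = exp (2 * pi * v)"
    and "\<And>n. n \<ge> 1 \<Longrightarrow> q n = exp (- pi * inverse (lam n))"
    and "\<And>n w. n \<ge> 1 \<Longrightarrow>
           G n w = qseries_g (map (\<lambda>a. q n powr a) \<alpha>) (map (\<lambda>b. q n powr b) \<beta>) (q n) l w"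
  shows "(\<exists>E :: nat \<Rightarrow> real \<Rightarrow> real.
            (\<forall>n\<ge>1. \<forall>v.
               G n (- of_real (q n powr (- 4 * real n * l) * z v)) =
               of_real (exp (pi * lam n / l * (v + 2 * real n * l / lam n)\<^sup>2)
                        * sqrt (lam n / l) * (1 + E n v))) \<and>
            bigo_loc_unif E (\<lambda>n v. exp (- pi * lam n / l))) \<and>
         (\<exists>E :: nat \<Rightarrow> real \<Rightarrow> real.
            (\<forall>n\<ge>1. \<forall>v.
               G n (of_real (q n powr (- 4 * real n * l) * z v)) =
               of_real (exp (pi * lam n / l * (v + 2 * real n * l / lam n)\<^sup>2 - pi * lam n / (4 * l))
                        * (2 * sqrt (lam n / l)) * (cos (pi * lam n * v / l) + E n v))) \<and>
            bigo_loc_unif E (\<lambda>n v. exp (- 2 * pi * lam n / l)))"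
proof -
  note adm = assms(1) and l = assms(2) and z = assms(5) and q = assms(6) and G = assms(7)
  have lam: "lam n > 0" if "n \<ge> 1" for n using adm that by (auto simp: admissible_scale_def)
  have q': "q n = exp (- pi / lam n)" if "n \<ge> 1" for n using q[OF that] by (simp add: divide_inverse)
  define c where "c = (\<lambda>n. qcoeff (map (\<lambda>a. exp (- pi / lam n) powr a) \<alpha>) (map (\<lambda>b. exp (- pi / lam n) powr b) \<beta>) (exp (- pi / lam n)))"
  obtain C where C: "C \<ge> 0" "\<And>n. lam n > 0 \<Longrightarrow> \<exists>K. \<forall>k. \<bar>c n k - 1\<bar> \<le> K"
    "\<And>n k. lam n \<ge> 1 \<Longrightarrow> \<bar>c n k - 1\<bar> \<le> exp (C * (lam n)\<^sup>2 * exp (- pi * real k / lam n)) - 1"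
    using qcoeff_scale_bound[OF assms(3,4)] unfolding c_def by metis
  define t where "t = (\<lambda>n. l / lam n)"
  define X where "X = (\<lambda>n v. 2 * real n + v / t n)"
  define T where "T = (\<lambda>s n v. weighted_gauss_sum s (c n) (t n) (X n v))"
  define F where "F = (\<lambda>s n v. \<Sum>k. s ^ k * (gauss (t n) (- X n v + real k) + s * gauss (t n) (- X n v - real k - 1)))"
  have t: "t n > 0" if "n \<ge> 1" for n using lam[OF that] l by (simp add: t_def)
  have GT: "G n (of_real (- (s * (q n powr (- 4 * real n * l) * z v)))) =
      of_real (exp (pi * lam n / l * (v + 2 * real n * l / lam n)\<^sup>2) * T s n v)" 
    if n: "n \<ge> 1" and s: "\<bar>s\<bar> = 1" for n s v
  proof -
    obtain K where K: "\<And>k. \<bar>c n k - 1\<bar> \<le> K" using C(2)[OF lam[OF n]] by auto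
    have bound: "norm (s ^ k * c n k * gauss (t n) (real k - X n v)) \<le> (K + 1) * gauss (t n) (real k - X n v)" for k
    proof -
      have "\<bar>c n k\<bar> \<le> K + 1" using K[of k] by linarith
      then have "\<bar>c n k\<bar> * gauss (t n) (real k - X n v) \<le> (K + 1) * gauss (t n) (real k - X n v)"
        by (intro mult_right_mono gauss_nonneg)
      then show ?thesis using s by (simp add: abs_mult power_abs gauss_nonneg)
    qed
    have sg: "summable (\<lambda>k. gauss (t n) (real k - X n v))"
      using summable_gauss[OF t[OF n], of "- X n v"] by (simp only: add.commute diff_conv_add_uminus)
    have sm: "summable (\<lambda>k. s ^ k * c n k * gauss (t n) (real k - X n v))"
      by (rule summable_comparison_test'[OF summable_mult[OF sg, of "K + 1"], of 0]) (rule bound)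
    show ?thesis
      unfolding G[OF n] q'[OF n] z T_def weighted_gauss_sum_def c_def t_def X_def
      by (rule qseries_g_gauss[OF lam[OF n] l sm[unfolded c_def t_def X_def]])
  qed
  have sqrt_t: "sqrt (t n) * sqrt (lam n / l) = 1" if "n \<ge> 1" for n
    using lam[OF that] l by (simp add: t_def real_sqrt_mult[symmetric])
  \<comment> \<open>\<open>3 \<pi> / l\<close> beats both error terms, also after division by \<open>exp (- \<pi> lam / (4 l))\<close> in the
    alternating case\<close>
  have approx: "\<forall>\<^sub>F n in sequentially. \<forall>v s. \<bar>v\<bar> \<le> V \<longrightarrow> \<bar>s\<bar> = 1 \<longrightarrow> sqrt (t n) * \<bar>T s n v - F s n v\<bar> \<le> 7 * exp (- (3 * pi / l) * lam n)"
    if "V \<ge> 0" for V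
    unfolding T_def F_def X_def t_def
    by (rule weighted_gauss_sum_approx[OF adm l C(1) that]) (use C(3) l in auto)
  have half: "\<forall>\<^sub>F n in sequentially. 1 \<le> lam n \<and> exp (- pi / t n) \<le> 1 / 2"
    using admissible_scale_eventually[OF adm, of "1 + l", OF add_nonneg_nonneg[OF zero_le_one less_imp_le[OF l]]]
    by eventually_elim (use l exp_neg_pi_le_half[OF l] in \<open>simp only: t_def, force\<close>)
  have pit: "pi / t n = pi * lam n / l" for n by (simp add: t_def)
  define E1 where "E1 = (\<lambda>n v. sqrt (t n) * T 1 n v - 1)"
  define E2 where "E2 = (\<lambda>n v. sqrt (t n) * T (-1) n v / (2 * exp (- pi / (4 * t n))) - cos (pi * lam n * v / l))"
  show ?thesis
  proof (rule conjI[OF exI[of _ E1] exI[of _ E2]]; intro conjI allI impI)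
    fix n :: nat and v :: real assume n: "n \<ge> 1"
    have "sqrt (lam n / l) * (1 + E1 n v) = (sqrt (t n) * sqrt (lam n / l)) * T 1 n v"
      by (simp add: E1_def mult_ac)
    then have "sqrt (lam n / l) * (1 + E1 n v) = T 1 n v" unfolding sqrt_t[OF n] by simp
    then show "G n (- of_real (q n powr (- 4 * real n * l) * z v)) =
               of_real (exp (pi * lam n / l * (v + 2 * real n * l / lam n)\<^sup>2)
                        * sqrt (lam n / l) * (1 + E1 n v))"
      using GT[OF n, of 1 v] by (simp add: mult.assoc)
  next
    fix n :: nat and v :: real assume n: "n \<ge> 1"
    have "exp (- (pi * lam n / (4 * l))) * (2 * sqrt (lam n / l)) * (cos (pi * lam n * v / l) + E2 n v)
      = (sqrt (t n) * sqrt (lam n / l)) * T (-1) n v"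
      by (simp add: E2_def t_def mult_ac)
    then have e: "exp (- (pi * lam n / (4 * l))) * (2 * sqrt (lam n / l)) * (cos (pi * lam n * v / l) + E2 n v) = T (-1) n v"
      unfolding sqrt_t[OF n] by simp
    have "exp (pi * lam n / l * (v + 2 * real n * l / lam n)\<^sup>2 - pi * lam n / (4 * l))
                        * (2 * sqrt (lam n / l)) * (cos (pi * lam n * v / l) + E2 n v) =
         exp (pi * lam n / l * (v + 2 * real n * l / lam n)\<^sup>2) * T (-1) n v"
      unfolding e[symmetric] diff_conv_add_uminus exp_add by (simp only: mult.assoc)
    then show "G n (of_real (q n powr (- 4 * real n * l) * z v)) =
               of_real (exp (pi * lam n / l * (v + 2 * real n * l / lam n)\<^sup>2 - pi * lam n / (4 * l))
                        * (2 * sqrt (lam n / l)) * (cos (pi * lam n * v / l) + E2 n v))"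
      using GT[OF n, of "-1" v] by simp
  next
    show "bigo_loc_unif E1 (\<lambda>n v. exp (- pi * lam n / l))"
    proof (rule bigo_loc_unifI, rule exI)
      fix V :: real assume V: "V \<ge> 0"
      show "\<forall>\<^sub>F n in sequentially. \<forall>v. \<bar>v\<bar> \<le> V \<longrightarrow> \<bar>E1 n v\<bar> \<le> 11 * \<bar>exp (- pi * lam n / l)\<bar>"
        using approx[OF V] half eventually_ge_at_top[of 1]
      proof (eventually_elim, intro allI impI)
        fix n :: nat and v :: real
        assume ap: "\<forall>v s. \<bar>v\<bar> \<le> V \<longrightarrow> \<bar>s\<bar> = 1 \<longrightarrow> sqrt (t n) * \<bar>T s n v - F s n v\<bar> \<le> 7 * exp (- (3 * pi / l) * lam n)"
          and h: "1 \<le> lam n \<and> exp (- pi / t n) \<le> 1 / 2" and n: "1 \<le> n" and v: "\<bar>v\<bar> \<le> V"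
        have "F 1 n v = gauss_sum (t n) (- X n v)" by (simp add: F_def gauss_sum_def)
        then have "\<bar>sqrt (t n) * F 1 n v - 1\<bar> \<le> 4 * exp (- pi * lam n / l)"
          using gauss_sum_asymp[OF t[OF n]] h by (simp add: pit)
        moreover have "\<bar>sqrt (t n) * T 1 n v - sqrt (t n) * F 1 n v\<bar> \<le> 7 * exp (- (3 * pi / l) * lam n)"
          using ap v t[OF n] by (simp add: right_diff_distrib[symmetric] abs_mult)
        moreover have "exp (- (3 * pi / l) * lam n) \<le> exp (- pi * lam n / l)"
          using l h by (simp add: divide_right_mono)
        ultimately have "\<bar>E1 n v\<bar> \<le> 4 * exp (- pi * lam n / l) + 7 * exp (- pi * lam n / l)"
          unfolding E1_def by linarith
        then show "\<bar>E1 n v\<bar> \<le> 11 * \<bar>exp (- pi * lam n / l)\<bar>" by simp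
      qed
    qed
  next
    show "bigo_loc_unif E2 (\<lambda>n v. exp (- 2 * pi * lam n / l))"
    proof (rule bigo_loc_unifI, rule exI)
      fix V :: real assume V: "V \<ge> 0"
      show "\<forall>\<^sub>F n in sequentially. \<forall>v. \<bar>v\<bar> \<le> V \<longrightarrow> \<bar>E2 n v\<bar> \<le> 6 * \<bar>exp (- 2 * pi * lam n / l)\<bar>"
        using approx[OF V] half eventually_ge_at_top[of 1]
      proof (eventually_elim, intro allI impI)
        fix n :: nat and v :: real
        assume ap: "\<forall>v s. \<bar>v\<bar> \<le> V \<longrightarrow> \<bar>s\<bar> = 1 \<longrightarrow> sqrt (t n) * \<bar>T s n v - F s n v\<bar> \<le> 7 * exp (- (3 * pi / l) * lam n)"
          and h: "1 \<le> lam n \<and> exp (- pi / t n) \<le> 1 / 2" and n: "1 \<le> n" and v: "\<bar>v\<bar> \<le> V"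
        define D where "D = 2 * exp (- pi / (4 * t n))"
        have D: "D > 0" by (simp add: D_def)
        have Deq: "D = 2 * exp (- (pi * lam n / (4 * l)))" by (simp add: D_def t_def)
        have "cos (pi * (- X n v)) = cos (2 * real n * pi + pi * v / t n)"
          using cos_minus[of "pi * X n v"] by (simp add: X_def algebra_simps)
        also have "\<dots> = cos (pi * lam n * v / l)"
          unfolding cos_add cos_2npi sin_2npi by (simp add: t_def mult_ac)
        finally have cosX: "cos (pi * (- X n v)) = cos (pi * lam n * v / l)" .
        have "F (-1) n v = (\<Sum>k. (-1) ^ k * (gauss (t n) (- X n v + real k) - gauss (t n) (- X n v - real k - 1)))"
          by (simp add: F_def)
        then have "\<bar>sqrt (t n) * F (-1) n v / D - cos (pi * lam n * v / l)\<bar> \<le> 2 * exp (- 2 * pi / t n)"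
          using gauss_sum_alternating_asymp[OF t[OF n], of "- X n v"] h unfolding cosX D_def by simp
        moreover have "- 2 * pi / t n = - 2 * pi * lam n / l" by (simp add: t_def)
        ultimately have F: "\<bar>sqrt (t n) * F (-1) n v / D - cos (pi * lam n * v / l)\<bar> \<le> 2 * exp (- 2 * pi * lam n / l)"
          by (simp only:)
        have "\<bar>sqrt (t n) * T (-1) n v - sqrt (t n) * F (-1) n v\<bar> \<le> 7 * exp (- (3 * pi / l) * lam n)"
          using ap v t[OF n] by (simp add: right_diff_distrib[symmetric] abs_mult)
        then have "\<bar>sqrt (t n) * T (-1) n v - sqrt (t n) * F (-1) n v\<bar> / D \<le> 7 * exp (- (3 * pi / l) * lam n) / D"
          using D by (intro divide_right_mono) auto
        also have "7 * exp (- (3 * pi / l) * lam n) / D = 7 / 2 * exp (- (3 * pi / l) * lam n + pi * lam n / (4 * l))"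
        proof -
          have "7 * a / (2 * inverse e) = 7 / 2 * (a * e)" if "e > 0" for a e :: real using that by (simp add: field_simps)
          then show ?thesis unfolding Deq exp_add exp_minus[of "pi * lam n / (4 * l)"] by simp
        qed
        also have "\<dots> \<le> 7 / 2 * exp (- 2 * pi * lam n / l)"
        proof -
          have "0 \<le> pi * lam n / l" using l h by simp
          moreover have "- (3 * pi / l) * lam n = - 3 * (pi * lam n / l)" "pi * lam n / (4 * l) = (pi * lam n / l) / 4"
            "- 2 * pi * lam n / l = - 2 * (pi * lam n / l)" by simp_all
          ultimately have "- (3 * pi / l) * lam n + pi * lam n / (4 * l) \<le> - 2 * pi * lam n / l" by linarith
          then show ?thesis by simp
        qed
        finally have "\<bar>sqrt (t n) * T (-1) n v / D - sqrt (t n) * F (-1) n v / D\<bar> \<le> 7 / 2 * exp (- 2 * pi * lam n / l)"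
          using D by (simp add: diff_divide_distrib[symmetric])
        moreover have "E2 n v = sqrt (t n) * T (-1) n v / D - cos (pi * lam n * v / l)" by (simp add: E2_def D_def)
        ultimately have "\<bar>E2 n v\<bar> \<le> 2 * exp (- 2 * pi * lam n / l) + 7 / 2 * exp (- 2 * pi * lam n / l)"
          using F by linarith
        then show "\<bar>E2 n v\<bar> \<le> 6 * \<bar>exp (- 2 * pi * lam n / l)\<bar>" by simp
      qed
    qed
  qed
qed

end
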